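(* Let $x(t)\in\mathbb{R}^2$ be a solution of the planar Kepler problem $\ddot x=-x/|x|^3$ with negative energy, nonzero angular momentum $\mathbb{L}=x_1\dot x_2-\dot x_1x_2$ and positive eccentricity, so that its orbit is a non-circular ellipse with one focus at the origin. Let $a$ and $b$ be the semimajor and semiminor axes of this orbit. Then the numerical precession rate of the Störmer–Verlet method with step size $h$ is, as $h\to0$, $$-\operatorname{sgn}(\mathbb{L})\,\frac{\pi}{24}\left(15\,\frac{a^3}{b^6}-3\,\frac{a}{b^4}\right)h^2+\mathcal{O}(h^4).$$
   Context: $|\cdot|$ is the Euclidean norm and $\langle\cdot,\cdot\rangle$ the standard scalar product on $\mathbb{R}^2$. The Kepler problem has Lagrangian $\frac12|\dot x|^2+\frac1{|x|}$, i.e. potential $U(x)=-1/|x|$ and equation of motion $\ddot x=f(x)$ with $f(x)=-x/|x|^3$. An orbit with semimajor axis $a$ has period $T=2\pi a^{3/2}$. Störmer–Verlet method with step size $h$: $$\frac{x_{k+1}-2x_k+x_{k-1}}{h^2}=f(x_k).$$ Modified equation: the modified equation of the method is the second order differential equation (a formal power series in $h$ perturbing $\ddot x=f(x)$) whose solutions interpolate the discrete solutions, $x_k=x(kh)$. It is truncated after the first nontrivial term (order $h^2$). For the Störmer–Verlet method applied to the Kepler problem, the modified equation agrees, up to a defect of order $\mathcal{O}(h^4)$, with the Euler–Lagrange equation of the modified Lagrangian $$\mathcal{L}_{\mathrm{mod},2}(x,\dot x)=\frac12|\dot x|^2+\frac1{|x|}+\frac{h^2}{24}\left(\frac1{|x|^4}-2\frac{|\dot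 x|^2}{|x|^3}+6\frac{\langle x,\dot x\rangle^2}{|x|^5}\right).$$ Laplace–Runge–Lenz (LRL) vector: the vector $(A,B)$ with $$A(x,\dot x)=|\dot x|^2x_1-\langle x,\dot x\rangle\dot x_1-\frac{x_1}{|x|},\qquad B(x,\dot x)=|\dot x|^2x_2-\langle x,\dot x\rangle\dot x_2-\frac{x_2}{|x|}.$$ It is constant along exact Kepler solutions and its magnitude is the eccentricity $e=\sqrt{1-b^2/a^2}$. Let $\omega$ be the (continuously chosen) angle of $(A,B)$ with the first coordinate axis, $\omega=\arctan(B/A)$. Numerical precession rate: the change of $\omega$ along the solution of the modified equation (truncated after the first nontrivial term, of order $h^2$, i.e. the Euler–Lagrange equation of $\mathcal{L}_{\mathrm{mod},2}$, up to a defect $\mathcal{O}(h^4)$), started from the same initial position and velocity as the exact solution, over a time interval of length $T$, where $T$ is the period of the exact solution. The exact solution (its initial data) is fixed as $h\to0$. *)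

theory Defs
  imports "HOL-Analysis.Analysis" "HOL-Library.Landau_Symbols"
begin

definition kepler_force :: "real^2 \<Rightarrow> real^2" where
  "kepler_force x = - (1 / norm x ^ 3) *\<^sub>R x"

definition kepler_energy :: "real^2 \<Rightarrow> real^2 \<Rightarrow> real" where
  "kepler_energy x v = norm v ^ 2 / 2 - 1 / norm x"

definition angular_momentum :: "real^2 \<Rightarrow> real^2 \<Rightarrow> real" where
  "angular_momentum x v = x $ 1 * v $ 2 - v $ 1 * x $ 2"

definition lrl_vector :: "real^2 \<Rightarrow> real^2 \<Rightarrow> real^2" where
  "lrl_vector x v = norm v ^ 2 *\<^sub>R x - (x \<bullet> v) *\<^sub>R v - (1 / norm x) *\<^sub>R x"

text \<open>
  The curve \<open>y\<close>, with velocity \<open>v\<close>, stays in \<open>S\<close> and solves \<open>y'' = F y y'\<close> on \<open>I\<close> with a defect of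
  norm at most \<open>\<epsilon>\<close>; for \<open>\<epsilon> = 0\<close> it is an exact solution. Derivatives are one-sided at end points
  of \<open>I\<close>.
\<close>
definition solves_second_order ::
  "(real^2 \<Rightarrow> real^2 \<Rightarrow> real^2) \<Rightarrow> (real^2) set \<Rightarrow> real \<Rightarrow> real set \<Rightarrow>
   (real \<Rightarrow> real^2) \<Rightarrow> (real \<Rightarrow> real^2) \<Rightarrow> bool" where
  "solves_second_order F S \<epsilon> I y v \<longleftrightarrow>
     (\<forall>t\<in>I. y t \<in> S \<and>
        (y has_vector_derivative v t) (at t within I) \<and>
        (\<exists>w. (v has_vector_derivative w) (at t within I) \<and> norm (w - F (y t) (v t)) \<le> \<epsilon>))"

text \<open>The residual of three consecutive positions in the Stoermer-Verlet scheme with step size \<open>h\<close>.\<close>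
definition verlet_residual ::
  "(real^2 \<Rightarrow> real^2) \<Rightarrow> real \<Rightarrow> real^2 \<Rightarrow> real^2 \<Rightarrow> real^2 \<Rightarrow> real^2" where
  "verlet_residual f h x_prev x_cur x_next =
     (1 / h ^ 2) *\<^sub>R (x_next - 2 *\<^sub>R x_cur + x_prev) - f x_cur"

definition C1_differentiable ::
  "('a::real_normed_vector) set \<Rightarrow> ('a \<Rightarrow> 'b::real_normed_vector) \<Rightarrow> bool" where
  "C1_differentiable U G \<longleftrightarrow>
     (\<exists>G'. (\<forall>z\<in>U. (G has_derivative blinfun_apply (G' z)) (at z)) \<and> continuous_on U G')"

definition truncated_modified_force ::
  "(real^2 \<Rightarrow> real^2) \<Rightarrow> (real^2 \<Rightarrow> real^2 \<Rightarrow> real^2) \<Rightarrow> real \<Rightarrow> real^2 \<Rightarrow> real^2 \<Rightarrow> real^2" where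
  "truncated_modified_force f g h x v = f x + h ^ 2 *\<^sub>R g x v"

text \<open>
  \<open>y'' = f y + h\<^sup>2 g y y'\<close> is the modified equation of the Stoermer-Verlet method for \<open>y'' = f y\<close> on
  \<open>S\<close>, truncated after the term of order \<open>h\<^sup>2\<close>: its solutions, sampled with step size \<open>h\<close>,
  satisfy the scheme up to the order \<open>h\<^sup>4\<close> of the first omitted term. By the symmetry of the
  scheme its modified equation has no odd powers of \<open>h\<close>. Each phase point \<open>(p, q)\<close> may serve as
  the middle one of three consecutive points, and this determines \<open>g\<close> on \<open>S\<close>; the \<open>C\<^sup>1\<close>
  requirement makes the differential equation uniquely solvable near each such point, so that the
  condition is never void.
\<close>
definition verlet_modified_term ::
  "(real^2 \<Rightarrow> real^2) \<Rightarrow> (real^2) set \<Rightarrow> (real^2 \<Rightarrow> real^2 \<Rightarrow> real^2) \<Rightarrow> bool" where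
  "verlet_modified_term f S g \<longleftrightarrow>
     C1_differentiable (S \<times> UNIV) (\<lambda>(x, v). g x v) \<and>
     (\<forall>Y V p q. p \<in> S \<longrightarrow>
        (\<forall>\<^sub>F h in at_right 0.
           solves_second_order (truncated_modified_force f g h) S 0 {-h..h} (Y h) (V h) \<and>
           Y h 0 = p \<and> V h 0 = q) \<longrightarrow>
        (\<lambda>h. norm (verlet_residual f h (Y h (-h)) (Y h 0) (Y h h))) \<in> O[at_right 0](\<lambda>h. h ^ 4))"

text \<open>The set \<open>E\<close> is the ellipse with foci \<open>F\<^sub>1\<close>, \<open>F\<^sub>2\<close> and semiaxes \<open>a \<ge> b\<close>.\<close>
definition is_ellipse ::
  "real^2 \<Rightarrow> real^2 \<Rightarrow> real \<Rightarrow> real \<Rightarrow> (real^2) set \<Rightarrow> bool" where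
  "is_ellipse F\<^sub>1 F\<^sub>2 a b E \<longleftrightarrow>
     0 < b \<and> b \<le> a \<and> dist F\<^sub>1 F\<^sub>2 = 2 * sqrt (a ^ 2 - b ^ 2) \<and>
     E = {p. dist p F\<^sub>1 + dist p F\<^sub>2 = 2 * a}"

definition is_minimal_period :: "(real \<Rightarrow> 'a) \<Rightarrow> real \<Rightarrow> bool" where
  "is_minimal_period x T \<longleftrightarrow>
     0 < T \<and> (\<forall>t. x (t + T) = x t) \<and> (\<forall>S. 0 < S \<and> S < T \<longrightarrow> (\<exists>t. x (t + S) \<noteq> x t))"

definition is_continuous_angle :: "real set \<Rightarrow> (real \<Rightarrow> real^2) \<Rightarrow> (real \<Rightarrow> real) \<Rightarrow> bool" where
  "is_continuous_angle I w \<omega> \<longleftrightarrow> continuous_on I \<omega> \<and>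
     (\<forall>t\<in>I. w t \<noteq> 0 \<and> w t $ 1 = norm (w t) * cos (\<omega> t) \<and> w t $ 2 = norm (w t) * sin (\<omega> t))"

text \<open>
  \<open>\<delta>\<close> is the change of the angle of the Laplace-Runge-Lenz vector over \<open>[0, T]\<close> along a solution,
  with initial data \<open>(x\<^sub>0, v\<^sub>0)\<close>, of the truncated modified equation with step size \<open>h\<close>, up to a
  defect of at most \<open>K h\<^sup>4\<close>. The case \<open>K = 0\<close> is the truncated modified equation itself;
  \<open>K > 0\<close> admits every equation that agrees with it up to order \<open>h\<^sup>4\<close>, such as the
  Euler-Lagrange equation of the modified Lagrangian.
\<close>
definition is_precession ::
  "(real^2 \<Rightarrow> real^2 \<Rightarrow> real^2) \<Rightarrow> real^2 \<Rightarrow> real^2 \<Rightarrow> real \<Rightarrow> real \<Rightarrow> real \<Rightarrow> real \<Rightarrow> bool" where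
  "is_precession g x\<^sub>0 v\<^sub>0 T K h \<delta> \<longleftrightarrow>
     (\<exists>y v \<omega>.
        solves_second_order (truncated_modified_force kepler_force g h) (- {0}) (K * h ^ 4) {0..T} y v \<and>
        y 0 = x\<^sub>0 \<and> v 0 = v\<^sub>0 \<and>
        is_continuous_angle {0..T} (\<lambda>t. lrl_vector (y t) (v t)) \<omega> \<and>
        \<delta> = \<omega> T - \<omega> 0)"

end

theory Submission
  imports Defs
begin

text \<open>
  Along a solution of \<open>y'' = f(y) + \<eta>\<close>, with \<open>f\<close> the Kepler force, the Laplace-Runge-Lenz vector
  changes at a rate that is linear in the perturbation \<open>\<eta>\<close> (\<open>lrl_vector_along_curve\<close>). For the truncated
  modified equation \<open>\<eta> = h\<^sup>2 g + O(h\<^sup>4)\<close>, so by Gronwall's inequality the solution stays within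
  \<open>O(h\<^sup>2)\<close> of the Kepler orbit over one period, and the rate may be evaluated on the unperturbed orbit
  with an error of \<open>O(h\<^sup>4)\<close> (\<open>lrl_vector_drift\<close>). The precession is thus, to leading order, the integral
  of an explicit function along a Kepler ellipse.

  Two things have to be known to compute this integral. The first is \<open>g\<close>. It is given only through
  the property that solutions of the modified equation satisfy the scheme up to \<open>O(h\<^sup>4)\<close>. Expanding
  the second difference of a solution \<open>y\<close> about a phase point yields
  \<open>y'' + (h\<^sup>2/12) y'''' = f(y) + o(h\<^sup>2)\<close>, which forces \<open>g = - (1/12) (f(y))''\<close>, the second derivative being
  taken along the unperturbed flow (\<open>verlet_modified_term_unique\<close>). To draw this conclusion one needs
  solutions through every phase point; they come from Picard iteration (\<open>local_flow\<close>).

  The second is the parametrisation of the orbit by the true anomaly \<open>\<theta>\<close>, the angle between \<open>x\<close> and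
  the Laplace-Runge-Lenz vector. It satisfies \<open>\<theta>' = L / |x|\<^sup>2\<close>, and it turns by exactly \<open>2 \<pi> sgn L\<close> during the
  minimal period (\<open>true_anomaly_over_period\<close>). In terms of \<open>\<theta>\<close> the integrand is a trigonometric
  polynomial, so only its mean contributes, which is \<open>- e\<^sup>2 (4 + e\<^sup>2) / (16 L\<^sup>6)\<close> (\<open>precession_integrand_eq\<close>,
  \<open>precession_primitive_derivative\<close>). Dividing by \<open>e\<^sup>2\<close> turns the transversal displacement of the vector
  into an angle (\<open>arctan_angle_expansion\<close>), and the relations \<open>L\<^sup>2 = b\<^sup>2 / a\<close> and \<open>e\<^sup>2 = 1 - b\<^sup>2 / a\<^sup>2\<close>
  (\<open>ellipse_focal_equation\<close>) give the stated coefficient.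
\<close>

section \<open>Existence and stability of solutions of differential equations\<close>

lemma vector_derivative_bound:
  fixes f :: "real \<Rightarrow> 'a::real_normed_vector"
  assumes "a \<le> b"
    and der: "\<And>t. t \<in> {a..b} \<Longrightarrow> (f has_vector_derivative f' t) (at t within {a..b})"
    and bd: "\<And>t. t \<in> {a..b} \<Longrightarrow> norm (f' t) \<le> B"
  shows "norm (f b - f a) \<le> B * (b - a)"
proof -
  have "norm (f b - f a) \<le> B * norm (b - a)"
  proof (rule differentiable_bound[where S = "{a..b}" and f' = "\<lambda>t u. u *\<^sub>R f' t"])
    show "onorm (\<lambda>u. u *\<^sub>R f' t) \<le> B" if "t \<in> {a..b}" for t
      using bd[OF that] by (intro onorm_le) (simp add: mult.commute[of B] mult_left_mono)
  qed (use assms in \<open>auto simp: has_vector_derivative_def\<close>)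
  then show ?thesis using assms(1) by simp
qed

text \<open>
  Picard's theorem on an interval of any length. The unknown is \<open>y = y\<^sub>0 + exp (k t) z\<close> with \<open>z\<close> bounded:
  the exponential weight makes the integral operator a contraction without a bound on the length, so
  that no continuation of local solutions is needed.
\<close>

lemma lipschitz_ivp_exists:
  fixes G :: "real \<Rightarrow> 'a::banach \<Rightarrow> 'a"
  assumes T: "0 \<le> T" and C: "0 \<le> C"
    and cont: "continuous_on ({0..T} \<times> UNIV) (\<lambda>(t, z). G t z)"
    and lip: "\<And>t y z. t \<in> {0..T} \<Longrightarrow> norm (G t y - G t z) \<le> C * norm (y - z)"
  obtains y where "y 0 = y\<^sub>0"
    "\<And>t. t \<in> {0..T} \<Longrightarrow> (y has_vector_derivative G t (y t)) (at t within {0..T})"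
proof -
  define k where "k = 2 * C + 1"
  have k: "k > 0" "C / k \<le> 1 / 2" using C by (auto simp: k_def field_simps)
  \<comment> \<open>Clamping the time to the interval extends every function on it to a bounded continuous one on the line.\<close>
  define \<tau> :: "real \<Rightarrow> real" where "\<tau> t = max 0 (min T t)" for t
  have \<tau>: "\<tau> t \<in> {0..T}" for t using T by (auto simp: \<tau>_def)
  have \<tau>_id: "\<tau> t = t" if "t \<in> {0..T}" for t using that by (auto simp: \<tau>_def)
  define R where "R z s = G s (y\<^sub>0 + exp (k * s) *\<^sub>R apply_bcontfun z s)" for z s
  have contR: "continuous_on {0..T} (R z)" for z
  proof -
    have "continuous_on {0..T} ((\<lambda>(t, z). G t z) \<circ> (\<lambda>s. (s, y\<^sub>0 + exp (k * s) *\<^sub>R apply_bcontfun z s)))"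
      by (intro continuous_on_compose continuous_intros continuous_on_subset[OF cont]) auto
    then show ?thesis by (simp add: R_def[abs_def] o_def)
  qed
  define \<Phi> where "\<Phi> z t = exp (- k * t) *\<^sub>R integral {0..t} (R z)" for z t
  have cont\<Phi>: "continuous_on {0..T} (\<Phi> z)" for z
    unfolding \<Phi>_def[abs_def]
    by (intro continuous_intros indefinite_integral_continuous_1 integrable_continuous_real contR)
  have bc: "(\<lambda>t. \<Phi> z (\<tau> t)) \<in> bcontfun" for z
  proof -
    have "continuous_on UNIV (\<Phi> z \<circ> \<tau>)"
      by (intro continuous_on_compose continuous_on_subset[OF cont\<Phi>])
        (use \<tau> in \<open>auto simp: \<tau>_def[abs_def] intro!: continuous_intros\<close>)
    moreover have "bounded (range (\<lambda>t. \<Phi> z (\<tau> t)))"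
      by (rule bounded_subset[OF compact_imp_bounded[OF compact_continuous_image[OF cont\<Phi>[of z]]]])
        (use \<tau> in auto)
    ultimately show ?thesis by (simp add: bcontfun_def o_def)
  qed
  define \<Psi> where "\<Psi> z = Bcontfun (\<lambda>t. \<Phi> z (\<tau> t))" for z
  have \<Psi>: "apply_bcontfun (\<Psi> z) t = \<Phi> z (\<tau> t)" for z t
    using bc by (simp add: \<Psi>_def Bcontfun_inverse)
  have contr: "norm (\<Phi> y t - \<Phi> z t) \<le> 1 / 2 * dist y z" if t: "t \<in> {0..T}" for y z t
  proof -
    have sub: "{0..t} \<subseteq> {0..T}" using t by auto
    have int: "R y integrable_on {0..t}" for y
      by (intro integrable_continuous_real continuous_on_subset[OF contR sub])
    have expint: "((\<lambda>s. C * dist y z * exp (k * s)) has_integral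
        C * dist y z / k * exp (k * t) - C * dist y z / k * exp (k * 0)) {0..t}"
      using t k by (intro fundamental_theorem_of_calculus)
        (auto intro!: derivative_eq_intros simp: has_real_derivative_iff_has_vector_derivative[symmetric])
    have "norm (integral {0..t} (\<lambda>s. R y s - R z s))
      \<le> integral {0..t} (\<lambda>s. C * dist y z * exp (k * s))"
    proof (rule integral_norm_bound_integral)
      show "(\<lambda>s. R y s - R z s) integrable_on {0..t}" by (intro integrable_diff int)
      show "(\<lambda>s. C * dist y z * exp (k * s)) integrable_on {0..t}" using expint by blast
      fix s assume s: "s \<in> {0..t}"
      then have "norm (R y s - R z s) \<le> C * (exp (k * s) * dist (apply_bcontfun y s) (apply_bcontfun z s))"
        using sub lip[of s "y\<^sub>0 + exp (k * s) *\<^sub>R apply_bcontfun y s" "y\<^sub>0 + exp (k * s) *\<^sub>R apply_bcontfun z s"]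
        by (auto simp: R_def dist_norm simp flip: scaleR_diff_right)
      also have "\<dots> \<le> C * (exp (k * s) * dist y z)"
        using C by (intro mult_left_mono dist_bounded) auto
      finally show "norm (R y s - R z s) \<le> C * dist y z * exp (k * s)" by (simp add: mult_ac)
    qed
    also have "\<dots> = C * dist y z / k * (exp (k * t) - 1)"
      unfolding integral_unique[OF expint] by (simp add: right_diff_distrib)
    finally have I: "norm (integral {0..t} (\<lambda>s. R y s - R z s)) \<le> C * dist y z / k * (exp (k * t) - 1)" .
    have "norm (\<Phi> y t - \<Phi> z t) = exp (- k * t) * norm (integral {0..t} (\<lambda>s. R y s - R z s))"
      by (simp add: \<Phi>_def integral_diff[OF int int] flip: scaleR_diff_right)
    also have "\<dots> \<le> exp (- k * t) * (C * dist y z / k * (exp (k * t) - 1))"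
      by (intro mult_left_mono I) simp
    also have "\<dots> = C / k * dist y z * (1 - exp (- k * t))"
      by (simp add: algebra_simps flip: exp_add)
    also have "\<dots> \<le> 1 / 2 * dist y z * 1"
    proof (rule mult_mono)
      show "C / k * dist y z \<le> 1 / 2 * dist y z" using k by (intro mult_right_mono) auto
    qed (use k t in auto)
    finally show ?thesis by simp
  qed
  have "\<exists>!z. \<Psi> z = z"
  proof (rule banach_fix_type[of "1/2"])
    show "\<forall>y z. dist (\<Psi> y) (\<Psi> z) \<le> 1 / 2 * dist y z"
      by (intro allI dist_bound) (simp only: \<Psi> dist_norm[of "\<Phi> _ _"] contr[OF \<tau>])
  qed auto
  then obtain z where z: "\<Psi> z = z" by blast
  define y where "y t = y\<^sub>0 + integral {0..t} (R z)" for t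
  have zt: "apply_bcontfun z t = exp (- k * t) *\<^sub>R integral {0..t} (R z)" if "t \<in> {0..T}" for t
    using \<Psi>[of z t] \<tau>_id[OF that] by (simp add: z \<Phi>_def)
  have yt: "R z t = G t (y t)" if "t \<in> {0..T}" for t
    using zt[OF that] by (simp add: R_def y_def flip: exp_add)
  show thesis
  proof (rule that[of y])
    show "y 0 = y\<^sub>0" by (simp add: y_def)
    show "(y has_vector_derivative G t (y t)) (at t within {0..T})" if "t \<in> {0..T}" for t
      unfolding y_def[abs_def] yt[OF that, unfolded y_def, symmetric]
      using integral_has_vector_derivative[OF contR that]
      by (auto intro!: derivative_eq_intros)
  qed
qed

text \<open>
  The function \<open>exp (- 2 (M + 1) t) (|w|\<^sup>2 + \<epsilon>\<^sup>2)\<close> does not increase; working with the square avoids the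
  points where the norm is not differentiable.
\<close>

lemma gronwall:
  fixes w :: "real \<Rightarrow> 'a::real_inner"
  assumes s: "0 < s" and M: "0 \<le> M"
    and cont: "continuous_on {0..s} w"
    and der: "\<And>t. 0 < t \<Longrightarrow> t < s \<Longrightarrow> (w has_vector_derivative w' t) (at t)"
    and init: "w 0 = 0"
    and bd: "\<And>t. 0 < t \<Longrightarrow> t < s \<Longrightarrow> norm (w' t) \<le> M * norm (w t) + \<epsilon>"
    and \<epsilon>: "0 \<le> \<epsilon>"
  shows "norm (w s) \<le> \<epsilon> * exp ((M + 1) * s)"
proof -
  define k where "k = 2 * (M + 1)"
  define \<phi> where "\<phi> t = exp (- k * t) * (w t \<bullet> w t + \<epsilon>\<^sup>2)" for t
  have "\<phi> s \<le> \<phi> 0"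
  proof (rule DERIV_nonpos_imp_decreasing_open[OF less_imp_le[OF s]])
    show "continuous_on {0..s} \<phi>"
      unfolding \<phi>_def[abs_def] by (intro continuous_intros cont)
    fix t assume t: "0 < t" "t < s"
    let ?d = "exp (- k * t) * (2 * (w t \<bullet> w' t)) - k * exp (- k * t) * (w t \<bullet> w t + \<epsilon>\<^sup>2)"
    have "((\<lambda>t. w t \<bullet> w t) has_real_derivative 2 * (w t \<bullet> w' t)) (at t)"
      unfolding has_real_derivative_iff_has_vector_derivative has_vector_derivative_def
      using der[OF t, unfolded has_vector_derivative_def]
      by (auto intro!: derivative_eq_intros simp: inner_commute algebra_simps)
    then have "(\<phi> has_real_derivative ?d) (at t)"
      unfolding \<phi>_def[abs_def] by (auto intro!: derivative_eq_intros)
    moreover have "?d \<le> 0"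
    proof -
      have "w t \<bullet> w' t \<le> norm (w t) * norm (w' t)" by (rule norm_cauchy_schwarz)
      also have "\<dots> \<le> norm (w t) * (M * norm (w t) + \<epsilon>)"
        by (intro mult_left_mono bd t) auto
      also have "\<dots> = M * (w t \<bullet> w t) + norm (w t) * \<epsilon>"
        by (simp add: algebra_simps power2_eq_square flip: power2_norm_eq_inner)
      finally have "2 * (w t \<bullet> w' t) \<le> 2 * M * (w t \<bullet> w t) + 2 * norm (w t) * \<epsilon>" by simp
      also have "2 * norm (w t) * \<epsilon> \<le> w t \<bullet> w t + \<epsilon>\<^sup>2"
        using sum_squares_bound[of "norm (w t)" \<epsilon>] by (simp add: power2_norm_eq_inner)
      finally have "2 * (w t \<bullet> w' t) \<le> k * (w t \<bullet> w t + \<epsilon>\<^sup>2)"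
        using M mult_nonneg_nonneg[OF M zero_le_power2[of \<epsilon>]] inner_ge_zero[of "w t"] zero_le_power2[of \<epsilon>]
        unfolding k_def distrib_left distrib_right by linarith
      then have "exp (- k * t) * (2 * (w t \<bullet> w' t)) \<le> exp (- k * t) * (k * (w t \<bullet> w t + \<epsilon>\<^sup>2))"
        by (rule mult_left_mono) simp
      then show ?thesis by (simp only: mult_ac diff_le_0_iff_le)
    qed
    ultimately show "\<exists>y. (\<phi> has_real_derivative y) (at t) \<and> y \<le> 0" by blast
  qed
  then have "exp (- k * s) * (w s \<bullet> w s + \<epsilon>\<^sup>2) \<le> \<epsilon>\<^sup>2" by (simp add: \<phi>_def init)
  then have "w s \<bullet> w s + \<epsilon>\<^sup>2 \<le> \<epsilon>\<^sup>2 * exp (k * s)"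
    by (simp add: exp_minus field_simps)
  then have "w s \<bullet> w s \<le> \<epsilon>\<^sup>2 * exp (k * s)"
    using zero_le_power2[of \<epsilon>] by linarith
  then have "(norm (w s))\<^sup>2 \<le> (\<epsilon> * exp ((M + 1) * s))\<^sup>2"
    by (simp add: power2_norm_eq_inner power_mult_distrib k_def algebra_simps flip: exp_double)
  then show ?thesis by (rule power2_le_imp_le) (use \<epsilon> in simp)
qed

text \<open>
  The differential inequality is only available as long as \<open>w\<close> stays in a ball. Gronwall's estimate
  shows that \<open>w\<close> is then well inside the ball, so there is no first time of leaving it.
\<close>

lemma gronwall_bootstrap:
  fixes w :: "real \<Rightarrow> 'a::real_inner"
  assumes M: "0 \<le> M" and \<epsilon>: "0 \<le> \<epsilon>" and small: "\<epsilon> * exp ((M + 1) * T) < \<delta>"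
    and der: "\<And>t. t \<in> {0..T} \<Longrightarrow> (w has_vector_derivative w' t) (at t within {0..T})"
    and init: "w 0 = 0"
    and bd: "\<And>t. t \<in> {0..T} \<Longrightarrow> norm (w t) \<le> \<delta> \<Longrightarrow> norm (w' t) \<le> M * norm (w t) + \<epsilon>"
    and t: "t \<in> {0..T}"
  shows "norm (w t) \<le> \<epsilon> * exp ((M + 1) * T)"
proof -
  have cont: "continuous_on {0..T} w"
    using der by (intro continuous_on_vector_derivative)
  have est: "norm (w s) \<le> \<epsilon> * exp ((M + 1) * T)"
    if s: "s \<in> {0..T}" and below: "\<And>t. 0 \<le> t \<Longrightarrow> t < s \<Longrightarrow> norm (w t) \<le> \<delta>" for s
  proof (cases "s = 0")
    case True then show ?thesis using \<epsilon> init by simp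
  next
    case False
    have "norm (w s) \<le> \<epsilon> * exp ((M + 1) * s)"
    proof (rule gronwall[of s M w w'])
      show "continuous_on {0..s} w" using cont s by (auto intro: continuous_on_subset)
      show "(w has_vector_derivative w' t) (at t)" if "0 < t" "t < s" for t
        using der[of t] that s at_within_Icc_at[of 0 t T] by auto
    qed (use False s M \<epsilon> init below bd in auto)
    also have "\<dots> \<le> \<epsilon> * exp ((M + 1) * T)"
    proof (rule mult_left_mono)
      have "(M + 1) * s \<le> (M + 1) * T" using s M by (intro mult_left_mono) auto
      then show "exp ((M + 1) * s) \<le> exp ((M + 1) * T)" by simp
    qed fact
    finally show ?thesis .
  qed
  have "norm (w t) \<le> \<delta>" if "t \<in> {0..T}" for t
  proof (rule ccontr)
    assume "\<not> norm (w t) \<le> \<delta>"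
    \<comment> \<open>The first time at which the boundary of the ball is reached gives a contradiction.\<close>
    define S where "S = {t \<in> {0..T}. \<delta> \<le> norm (w t)}"
    have "closed S"
      unfolding S_def by (intro continuous_on_closed_Collect_le continuous_intros cont)
    moreover have "bounded S"
      by (rule bounded_subset[OF bounded_closed_interval[of 0 T]]) (auto simp: S_def)
    ultimately have "compact S" by (simp add: compact_eq_bounded_closed)
    moreover have "S \<noteq> {}" using that \<open>\<not> norm (w t) \<le> \<delta>\<close> by (auto simp: S_def)
    ultimately obtain s where s: "s \<in> S" and least: "\<And>r. r \<in> S \<Longrightarrow> s \<le> r"
      using compact_attains_inf[of S] by auto
    have "norm (w s) \<le> \<epsilon> * exp ((M + 1) * T)"
      using s least by (intro est) (force simp: S_def)+
    then show False using s small by (simp add: S_def)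
  qed
  then show ?thesis using t by (intro est) auto
qed

text \<open>
  The Lipschitz condition holds on a tube around \<open>z\<^sub>0\<close> only, and the defect of \<open>Z\<close> is controlled only
  while \<open>Z\<close> is in the tube; the estimate itself keeps it there.
\<close>

lemma solution_stability:
  fixes z\<^sub>0 Z :: "real \<Rightarrow> 'a::euclidean_space"
  assumes z\<^sub>0: "\<And>t. t \<in> {0..T} \<Longrightarrow> (z\<^sub>0 has_vector_derivative F (z\<^sub>0 t)) (at t within {0..T})"
    and tube: "\<And>t. t \<in> {0..T} \<Longrightarrow> cball (z\<^sub>0 t) \<delta> \<subseteq> N"
    and lip: "C-lipschitz_on N F"
    and Z: "\<And>t. t \<in> {0..T} \<Longrightarrow> (Z has_vector_derivative Z' t) (at t within {0..T})"
    and init: "Z 0 = z\<^sub>0 0"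
    and defect: "\<And>t. t \<in> {0..T} \<Longrightarrow> norm (Z t - z\<^sub>0 t) \<le> \<delta> \<Longrightarrow> norm (Z' t - F (Z t)) \<le> \<epsilon>"
    and \<epsilon>: "0 \<le> \<epsilon>" "\<epsilon> * exp ((C + 1) * T) < \<delta>" and t: "t \<in> {0..T}"
  shows "norm (Z t - z\<^sub>0 t) \<le> \<epsilon> * exp ((C + 1) * T)"
proof (rule gronwall_bootstrap[where w = "\<lambda>t. Z t - z\<^sub>0 t" and w' = "\<lambda>t. Z' t - F (z\<^sub>0 t)" and T = T, OF _ \<epsilon>])
  fix t assume t: "t \<in> {0..T}"
  show "((\<lambda>t. Z t - z\<^sub>0 t) has_vector_derivative Z' t - F (z\<^sub>0 t)) (at t within {0..T})"
    by (intro has_vector_derivative_diff Z z\<^sub>0 t)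
  assume near: "norm (Z t - z\<^sub>0 t) \<le> \<delta>"
  then have "Z t \<in> N" "z\<^sub>0 t \<in> N"
    using tube[OF t] order_trans[OF norm_ge_zero near] by (auto simp: subset_iff dist_norm norm_minus_commute)
  then have "norm (F (Z t) - F (z\<^sub>0 t)) \<le> C * norm (Z t - z\<^sub>0 t)"
    using lipschitz_onD[OF lip] by (simp add: dist_norm)
  then show "norm (Z' t - F (z\<^sub>0 t)) \<le> C * norm (Z t - z\<^sub>0 t) + \<epsilon>"
    using norm_triangle_ineq[of "Z' t - F (Z t)" "F (Z t) - F (z\<^sub>0 t)"] defect[OF t near] by simp
qed (use init t lipschitz_on_nonneg[OF lip] in auto)

text \<open>
  The perturbed field is made globally Lipschitz by composing the displacement from \<open>z\<^sub>0\<close> with the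
  projection onto a ball. By stability the resulting solution never feels the projection.
\<close>

lemma perturbed_solution_exists:
  fixes z\<^sub>0 :: "real \<Rightarrow> 'a::euclidean_space"
  assumes z\<^sub>0: "\<And>t. t \<in> {0..T} \<Longrightarrow> (z\<^sub>0 has_vector_derivative F (z\<^sub>0 t)) (at t within {0..T})"
    and tube: "\<And>t. t \<in> {0..T} \<Longrightarrow> cball (z\<^sub>0 t) \<delta> \<subseteq> N"
    and lip: "C-lipschitz_on N F" and lip': "C'-lipschitz_on N F'"
    and close: "\<And>z. z \<in> N \<Longrightarrow> norm (F' z - F z) \<le> \<epsilon>"
    and \<epsilon>: "0 \<le> \<epsilon>" "\<epsilon> * exp ((C + 1) * T) < \<delta>" and T: "0 \<le> T"
  obtains Z where "Z 0 = z\<^sub>0 0"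
    "\<And>t. t \<in> {0..T} \<Longrightarrow> (Z has_vector_derivative F' (Z t)) (at t within {0..T})"
    "\<And>t. t \<in> {0..T} \<Longrightarrow> norm (Z t - z\<^sub>0 t) \<le> \<epsilon> * exp ((C + 1) * T)"
proof -
  define P :: "'a \<Rightarrow> 'a" where "P = closest_point (cball 0 \<delta>)"
  have "0 < \<delta>" using \<epsilon>(2) mult_nonneg_nonneg[OF \<epsilon>(1) exp_ge_zero[of "(C + 1) * T"]] by linarith
  then have ball: "convex (cball (0::'a) \<delta>)" "closed (cball (0::'a) \<delta>)" "cball (0::'a) \<delta> \<noteq> {}" by auto
  have PN: "z\<^sub>0 t + P u \<in> N" if "t \<in> {0..T}" for t u
  proof -
    have "P u \<in> cball 0 \<delta>" unfolding P_def by (rule closest_point_in_set[OF ball(2,3)])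
    then have "z\<^sub>0 t + P u \<in> cball (z\<^sub>0 t) \<delta>" by (simp add: dist_norm)
    then show ?thesis using tube[OF that] by blast
  qed
  define G where "G t z = F' (z\<^sub>0 t + P (z - z\<^sub>0 t))" for t z
  have C': "0 \<le> C'" by (rule lipschitz_on_nonneg[OF lip'])
  have cont0: "continuous_on {0..T} z\<^sub>0"
    using z\<^sub>0 by (intro continuous_on_vector_derivative)
  have "continuous_on ({0..T} \<times> UNIV) (\<lambda>w. F' (z\<^sub>0 (fst w) + P (snd w - z\<^sub>0 (fst w))))"
  proof (rule continuous_on_compose2[OF lipschitz_on_continuous_on[OF lip']])
    have fst0: "continuous_on ({0..T} \<times> UNIV) (\<lambda>w :: real \<times> 'a. z\<^sub>0 (fst w))"
      by (rule continuous_on_compose2[OF cont0]) (auto intro!: continuous_on_fst continuous_on_id)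
    have "continuous_on UNIV P" unfolding P_def by (rule continuous_on_closest_point[OF ball])
    then have "continuous_on ({0..T} \<times> UNIV) (\<lambda>w. P (snd w - z\<^sub>0 (fst w)))"
      by (rule continuous_on_compose2)
        (intro continuous_on_diff continuous_on_snd continuous_on_id fst0, simp)
    with fst0 show "continuous_on ({0..T} \<times> UNIV) (\<lambda>w. z\<^sub>0 (fst w) + P (snd w - z\<^sub>0 (fst w)))"
      by (rule continuous_on_add)
  qed (use PN in auto)
  then have cont: "continuous_on ({0..T} \<times> UNIV) (\<lambda>(t, z). G t z)"
    by (simp add: G_def case_prod_beta')
  have lipG: "norm (G t y - G t z) \<le> C' * norm (y - z)" if t: "t \<in> {0..T}" for t y z
  proof -
    have "dist (G t y) (G t z) \<le> C' * dist (z\<^sub>0 t + P (y - z\<^sub>0 t)) (z\<^sub>0 t + P (z - z\<^sub>0 t))"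
      unfolding G_def by (rule lipschitz_onD[OF lip' PN PN]) (rule t)+
    also have "\<dots> \<le> C' * dist (y - z\<^sub>0 t) (z - z\<^sub>0 t)"
      unfolding P_def using closest_point_lipschitz[OF ball] C' by (intro mult_left_mono) auto
    finally show ?thesis by (simp add: dist_norm)
  qed
  obtain Z where Z: "Z 0 = z\<^sub>0 0"
    "\<And>t. t \<in> {0..T} \<Longrightarrow> (Z has_vector_derivative G t (Z t)) (at t within {0..T})"
    using lipschitz_ivp_exists[OF T C' cont lipG] by metis
  have G_eq: "Z t \<in> N" "G t (Z t) = F' (Z t)" if "t \<in> {0..T}" "norm (Z t - z\<^sub>0 t) \<le> \<delta>" for t
  proof -
    have "P (Z t - z\<^sub>0 t) = Z t - z\<^sub>0 t"
      unfolding P_def using that by (intro closest_point_self) auto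
    then show "Z t \<in> N" "G t (Z t) = F' (Z t)"
      using PN[OF that(1), of "Z t - z\<^sub>0 t"] by (auto simp: G_def)
  qed
  have est: "norm (Z t - z\<^sub>0 t) \<le> \<epsilon> * exp ((C + 1) * T)" if "t \<in> {0..T}" for t
    by (rule solution_stability[OF z\<^sub>0 tube lip Z(2) Z(1) _ \<epsilon> that]) (use G_eq close in auto)
  have "norm (Z t - z\<^sub>0 t) \<le> \<delta>" if "t \<in> {0..T}" for t
    using est[OF that] \<epsilon> by simp
  then show thesis using Z G_eq by (intro that[OF Z(1) _ est]) auto
qed

lemma local_flow_forward:
  fixes F :: "'a::euclidean_space \<Rightarrow> 'a"
  assumes lip: "C-lipschitz_on (cball c \<delta>) F" and bd: "\<And>z. z \<in> cball c \<delta> \<Longrightarrow> norm (F z) \<le> B"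
    and d: "0 \<le> d" "B * d \<le> \<delta>" and \<delta>: "0 \<le> \<delta>"
  obtains z where "z 0 = c" "\<And>t. t \<in> {0..d} \<Longrightarrow> norm (z t - c) \<le> B * t"
    "\<And>t. t \<in> {0..d} \<Longrightarrow> (z has_vector_derivative F (z t)) (at t within {0..d})"
proof -
  define P where "P = closest_point (cball c \<delta>)"
  have P: "P z \<in> cball c \<delta>" for z
    unfolding P_def using \<delta> by (intro closest_point_in_set) auto
  have B: "B \<ge> 0" using bd[of c] \<delta> order_trans[OF norm_ge_zero[of "F c"]] by auto
  have lipP: "norm (F (P y) - F (P z)) \<le> C * norm (y - z)" for y z
  proof -
    have "dist (F (P y)) (F (P z)) \<le> C * dist (P y) (P z)"
      by (rule lipschitz_onD[OF lip P P])
    also have "\<dots> \<le> C * dist y z"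
      unfolding P_def using lipschitz_on_nonneg[OF lip] \<delta>
      by (intro mult_left_mono closest_point_lipschitz) auto
    finally show ?thesis by (simp add: dist_norm)
  qed
  have "continuous_on UNIV (\<lambda>z. F (P z))"
    using lipschitz_on_nonneg[OF lip] lipP
    by (intro lipschitz_on_continuous_on[of C] lipschitz_onI) (auto simp: dist_norm)
  then have cont: "continuous_on ({0..d} \<times> UNIV) (\<lambda>(t::real, z). F (P z))"
    unfolding case_prod_beta by (rule continuous_on_compose2) (auto intro!: continuous_intros)
  obtain z where z: "z 0 = c"
    and dz: "\<And>t. t \<in> {0..d} \<Longrightarrow> (z has_vector_derivative F (P (z t))) (at t within {0..d})"
    using lipschitz_ivp_exists[OF d(1) lipschitz_on_nonneg[OF lip] cont lipP] by metis
  have est: "norm (z t - c) \<le> B * t" if t: "t \<in> {0..d}" for t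
  proof -
    have "norm (z t - z 0) \<le> B * (t - 0)"
      by (rule vector_derivative_bound[where f' = "\<lambda>t. F (P (z t))"])
        (use t bd[OF P] in \<open>auto intro!: has_vector_derivative_within_subset[OF dz]\<close>)
    then show ?thesis using z by simp
  qed
  have "P (z t) = z t" if "t \<in> {0..d}" for t
  proof -
    have "B * t \<le> B * d" using B that by (intro mult_left_mono) auto
    then show ?thesis unfolding P_def using est[OF that] d
      by (intro closest_point_self) (auto simp: dist_norm norm_minus_commute)
  qed
  then show thesis using that[OF z est] dz by simp
qed

text \<open>
  The interval is two-sided because a three-term scheme looks at a solution on both sides of its
  middle point. The length \<open>d\<close> is restricted only by the bound \<open>B\<close> and the radius \<open>\<delta>\<close>, hence can be
  chosen uniformly for a family of fields.
\<close>

lemma local_flow: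
  fixes F :: "'a::euclidean_space \<Rightarrow> 'a"
  assumes lip: "C-lipschitz_on (cball c \<delta>) F" and bd: "\<And>z. z \<in> cball c \<delta> \<Longrightarrow> norm (F z) \<le> B"
    and d: "0 \<le> d" "B * d \<le> \<delta>" and \<delta>: "0 \<le> \<delta>"
  obtains z where "z 0 = c" "\<And>t. t \<in> {-d..d} \<Longrightarrow> norm (z t - c) \<le> B * \<bar>t\<bar>"
    "\<And>t. t \<in> {-d..d} \<Longrightarrow> (z has_vector_derivative F (z t)) (at t within {-d..d})"
proof -
  obtain p where p: "p 0 = c" "\<And>t. t \<in> {0..d} \<Longrightarrow> norm (p t - c) \<le> B * t"
    "\<And>t. t \<in> {0..d} \<Longrightarrow> (p has_vector_derivative F (p t)) (at t within {0..d})"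
    using local_flow_forward[OF lip bd d \<delta>] by blast
  have lip': "C-lipschitz_on (cball c \<delta>) (\<lambda>z. - F z)" using lip by simp
  obtain n where n: "n 0 = c" "\<And>t. t \<in> {0..d} \<Longrightarrow> norm (n t - c) \<le> B * t"
    "\<And>t. t \<in> {0..d} \<Longrightarrow> (n has_vector_derivative - F (n t)) (at t within {0..d})"
    using local_flow_forward[OF lip' _ d \<delta>] bd by (metis norm_minus_cancel)
  \<comment> \<open>The backward half is the forward solution for the reversed field, run in reverse.\<close>
  define m where "m t = n (- t)" for t
  have m: "(m has_vector_derivative F (m t)) (at t within {-d..0})" if "t \<in> {-d..0}" for t
  proof -
    have "(uminus has_vector_derivative (- 1 :: real)) (at t within {-d..0})"
      by (auto intro!: derivative_eq_intros)
    moreover have "(n has_vector_derivative - F (n (- t))) (at (- t) within uminus ` {-d..0})"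
      using n(3)[of "- t"] that by simp
    ultimately have "((n \<circ> uminus) has_vector_derivative (-1) *\<^sub>R (- F (n (- t)))) (at t within {-d..0})"
      by (rule vector_diff_chain_within)
    then show ?thesis by (simp add: m_def[abs_def] o_def)
  qed
  have m0: "m 0 = c" by (simp add: m_def n)
  define z where "z t = (if t \<in> {0..d} then p t else m t)" for t
  show thesis
  proof (rule that[of z])
    show "z 0 = c" using p d by (simp add: z_def)
    show "norm (z t - c) \<le> B * \<bar>t\<bar>" if "t \<in> {-d..d}" for t
      using p(2)[of t] n(2)[of "-t"] that by (auto simp: z_def m_def)
    show "(z has_vector_derivative F (z t)) (at t within {-d..d})" if t: "t \<in> {-d..d}" for t
    proof -
      have "((\<lambda>t. if t \<in> {0..d} then p t else m t) has_vector_derivative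
          (if t \<in> {0..d} then F (p t) else F (m t))) (at t within {-d..d})"
        by (rule has_vector_derivative_If_within_closures[where S = "{0..d}" and T = "{-d..0}"])
          (use t p(1,3) m0 m d in \<open>auto simp: insert_absorb Un_absorb2\<close>)
      then show ?thesis by (simp add: z_def[abs_def] if_distrib)
    qed
  qed
qed

section \<open>The Kepler force and the Laplace-Runge-Lenz vector along a curve\<close>

text \<open>
  The quarter turn. Its use is that \<open>rot a \<bullet> b\<close> is the planar cross product of \<open>a\<close> and \<open>b\<close>.
\<close>

definition rot :: "real^2 \<Rightarrow> real^2" where
  "rot a = vector [- a $ 2, a $ 1]"

lemma rot_nth [simp]: "rot a $ 1 = - a $ 2" "rot a $ 2 = a $ 1"
  by (simp_all add: rot_def)

lemma inner_2: "a \<bullet> b = a $ 1 * b $ 1 + a $ 2 * b $ 2" for a b :: "real^2"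
  by (simp add: inner_vec_def sum_2)

lemma norm_rot [simp]: "norm (rot a) = norm a"
  by (simp add: norm_eq_sqrt_inner inner_2 add.commute)

lemma rot_simps:
  "rot (a + b) = rot a + rot b" "rot (k *\<^sub>R a) = k *\<^sub>R rot a" "rot (rot a) = - a"
  "rot a \<bullet> rot b = a \<bullet> b" "rot a \<bullet> a = 0" "a \<bullet> rot a = 0" "a \<bullet> rot b = - (rot a \<bullet> b)"
  by (simp_all add: vec_eq_iff forall_2 inner_2 algebra_simps)

lemma has_real_derivative_inner:
  assumes "(f has_vector_derivative f') (at t within I)" "(g has_vector_derivative g') (at t within I)"
  shows "((\<lambda>s. f s \<bullet> g s) has_real_derivative f' \<bullet> g t + f t \<bullet> g') (at t within I)"
  using assms unfolding has_real_derivative_iff_has_vector_derivative has_vector_derivative_def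
  by (auto intro!: derivative_eq_intros simp: algebra_simps)

lemma has_real_derivative_norm:
  fixes f :: "real \<Rightarrow> 'a::real_inner"
  assumes f: "(f has_vector_derivative f') (at t within I)" and nz: "f t \<noteq> 0"
  shows "((\<lambda>s. norm (f s)) has_real_derivative (f t \<bullet> f') / norm (f t)) (at t within I)"
proof -
  have pos: "0 < f t \<bullet> f t" using nz by simp
  have "((\<lambda>s. sqrt (f s \<bullet> f s)) has_real_derivative (f t \<bullet> f') / norm (f t)) (at t within I)"
    using DERIV_chain2[OF DERIV_real_sqrt[OF pos] has_real_derivative_inner[OF f f]]
    by (simp add: norm_eq_sqrt_inner inner_commute field_simps)
  then show ?thesis by (simp add: norm_eq_sqrt_inner)
qed

lemma has_real_derivative_inverse_norm_power:
  fixes f :: "real \<Rightarrow> 'a::real_inner"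
  assumes f: "(f has_vector_derivative f') (at t within I)" and nz: "f t \<noteq> 0"
  shows "((\<lambda>s. 1 / norm (f s) ^ n) has_real_derivative - real n * (f t \<bullet> f') / norm (f t) ^ (n + 2)) (at t within I)"
proof (cases n)
  case (Suc k)
  have "((\<lambda>s. 1 / norm (f s) ^ Suc k) has_real_derivative
      - (real (Suc k) * ((f t \<bullet> f') / norm (f t)) * norm (f t) ^ k) / (norm (f t) ^ Suc k)\<^sup>2) (at t within I)"
    by (rule DERIV_power_Suc[OF has_real_derivative_norm[OF f nz]] derivative_eq_intros refl)+
      (use nz in \<open>simp_all add: power2_eq_square\<close>)
  also have "- (real (Suc k) * ((f t \<bullet> f') / norm (f t)) * norm (f t) ^ k) / (norm (f t) ^ Suc k)\<^sup>2
      = - real (Suc k) * (f t \<bullet> f') / norm (f t) ^ (Suc k + 2)"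
    using nz by (simp add: power2_eq_square field_simps)
  finally show ?thesis using Suc by simp
qed simp

text \<open>
  The first and second time derivatives of the force along a curve with position \<open>y\<close>, velocity \<open>v\<close>
  and acceleration \<open>a\<close>.
\<close>

definition kepler_force_deriv :: "real^2 \<Rightarrow> real^2 \<Rightarrow> real^2" where
  "kepler_force_deriv y v = (3 * (y \<bullet> v) * (1 / norm y ^ 5)) *\<^sub>R y - (1 / norm y ^ 3) *\<^sub>R v"

definition kepler_force_deriv2 :: "real^2 \<Rightarrow> real^2 \<Rightarrow> real^2 \<Rightarrow> real^2" where
  "kepler_force_deriv2 y v a = kepler_force_deriv y a + (6 * (y \<bullet> v) * (1 / norm y ^ 5)) *\<^sub>R v
     + (3 * (v \<bullet> v) * (1 / norm y ^ 5) - 15 * (y \<bullet> v)\<^sup>2 * (1 / norm y ^ 7)) *\<^sub>R y"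

lemma kepler_force_along_curve:
  assumes y: "(y has_vector_derivative v) (at t within I)" and nz: "y t \<noteq> 0"
  shows "((\<lambda>s. kepler_force (y s)) has_vector_derivative kepler_force_deriv (y t) v) (at t within I)"
  unfolding kepler_force_def
  by (rule y nz refl has_real_derivative_inner has_real_derivative_inverse_norm_power derivative_eq_intros)+
    (simp add: kepler_force_deriv_def algebra_simps)

lemma kepler_force_deriv_along_curve:
  assumes y: "(y has_vector_derivative v t) (at t within I)" and v: "(v has_vector_derivative a) (at t within I)"
    and nz: "y t \<noteq> 0"
  shows "((\<lambda>s. kepler_force_deriv (y s) (v s)) has_vector_derivative kepler_force_deriv2 (y t) (v t) a) (at t within I)"
  unfolding kepler_force_deriv_def
  by (rule y v nz refl has_real_derivative_inner has_real_derivative_inverse_norm_power derivative_eq_intros)+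
    (simp add: kepler_force_deriv2_def kepler_force_deriv_def vec_eq_iff algebra_simps power2_eq_square)

text \<open>
  The \<open>h\<^sup>2\<close> term of the modified equation: the fourth derivative of the unperturbed motion, which is the
  second derivative of the force, with the factor \<open>- 1 / 12\<close> from the Taylor expansion of the second
  difference.
\<close>

definition kepler_verlet_term :: "real^2 \<Rightarrow> real^2 \<Rightarrow> real^2" where
  "kepler_verlet_term y v = - (1 / 12) *\<^sub>R kepler_force_deriv2 y v (kepler_force y)"

definition lrl_rate :: "real^2 \<Rightarrow> real^2 \<Rightarrow> real^2 \<Rightarrow> real^2" where
  "lrl_rate y v \<eta> = (2 * (v \<bullet> \<eta>)) *\<^sub>R y - (y \<bullet> \<eta>) *\<^sub>R v - (y \<bullet> v) *\<^sub>R \<eta>"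

text \<open>
  The Kepler force itself does not contribute, which is the conservation law; since the rate is affine
  in the acceleration, only the deviation of the acceleration from the force is left.
\<close>

lemma lrl_vector_along_curve:
  assumes y: "(y has_vector_derivative v t) (at t within I)" and v: "(v has_vector_derivative a) (at t within I)"
    and nz: "y t \<noteq> 0"
  shows "((\<lambda>s. lrl_vector (y s) (v s)) has_vector_derivative
    lrl_rate (y t) (v t) (a - kepler_force (y t))) (at t within I)"
proof -
  have eq: "lrl_vector p q = (q \<bullet> q) *\<^sub>R p - (p \<bullet> q) *\<^sub>R q - (1 / norm p ^ 1) *\<^sub>R p" for p q
    by (simp add: lrl_vector_def power2_norm_eq_inner)
  have r: "(y t \<bullet> y t) * (1 / norm (y t) ^ 3) = 1 / norm (y t)"
    using nz by (simp add: power2_norm_eq_inner[symmetric] power2_eq_square power3_eq_cube)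
  have "((\<lambda>s. lrl_vector (y s) (v s)) has_vector_derivative
      (v t \<bullet> v t) *\<^sub>R v t + (2 * (v t \<bullet> a)) *\<^sub>R y t - ((y t \<bullet> v t) *\<^sub>R a + (v t \<bullet> v t + y t \<bullet> a) *\<^sub>R v t)
      - ((1 / norm (y t)) *\<^sub>R v t - ((y t \<bullet> v t) * (1 / norm (y t) ^ 3)) *\<^sub>R y t)) (at t within I)"
    unfolding eq
    by (rule y v nz refl has_real_derivative_inner has_real_derivative_inverse_norm_power derivative_eq_intros)+
      (simp add: inner_commute power3_eq_cube)
  moreover have regroup: "(q \<bullet> q) *\<^sub>R q + (2 * (q \<bullet> a)) *\<^sub>R p - ((p \<bullet> q) *\<^sub>R a + (q \<bullet> q + p \<bullet> a) *\<^sub>R q)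
      - (m *\<^sub>R q - ((p \<bullet> q) * n) *\<^sub>R p) =
      (2 * (q \<bullet> (a + n *\<^sub>R p))) *\<^sub>R p - (p \<bullet> (a + n *\<^sub>R p)) *\<^sub>R q - (p \<bullet> q) *\<^sub>R (a + n *\<^sub>R p)"
    if "(p \<bullet> p) * n = m" for p q :: "real^2" and m n
    using that[symmetric] by (simp add: inner_add_right inner_commute vec_eq_iff algebra_simps)
  ultimately show ?thesis
    using regroup[OF r, of "v t"] by (simp add: lrl_rate_def kepler_force_def)
qed

lemma angular_momentum_along_curve:
  assumes y: "(y has_vector_derivative v t) (at t within I)" and v: "(v has_vector_derivative a) (at t within I)"
  shows "((\<lambda>s. angular_momentum (y s) (v s)) has_real_derivative
    angular_momentum (y t) (a - kepler_force (y t))) (at t within I)"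
proof -
  note c = y[unfolded has_vector_derivative_def] v[unfolded has_vector_derivative_def]
  have comp: "((\<lambda>s. f s $ i) has_real_derivative f' $ i) (at t within I)"
    if "(f has_vector_derivative f') (at t within I)" for f :: "real \<Rightarrow> real^2" and f' i
    using bounded_linear.has_vector_derivative[OF bounded_linear_vec_nth that, of i]
    by (simp add: has_real_derivative_iff_has_vector_derivative)
  have "((\<lambda>s. angular_momentum (y s) (v s)) has_real_derivative
    angular_momentum (y t) a) (at t within I)"
    unfolding angular_momentum_def
    by (rule derivative_eq_intros comp y v refl)+ (simp add: algebra_simps)
  then show ?thesis by (simp add: angular_momentum_def kepler_force_def algebra_simps)
qed

section \<open>Bounded Lipschitz functions on compact parts of phase space\<close>

text \<open>
  Boundedness is included because it makes the property stable under products.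
\<close>

definition bounded_lipschitz_on :: "'a::metric_space set \<Rightarrow> ('a \<Rightarrow> 'b::real_normed_vector) \<Rightarrow> bool" where
  "bounded_lipschitz_on S f \<longleftrightarrow> (\<exists>C. C-lipschitz_on S f) \<and> bounded (f ` S)"

lemma bounded_lipschitz_onE:
  assumes "bounded_lipschitz_on S f"
  obtains C where "0 \<le> C" "C-lipschitz_on S f" "\<And>z. z \<in> S \<Longrightarrow> norm (f z) \<le> C"
proof -
  obtain C B where "C-lipschitz_on S f" "\<And>z. z \<in> S \<Longrightarrow> norm (f z) \<le> B"
    using assms unfolding bounded_lipschitz_on_def bounded_iff by auto
  then show thesis
    by (intro that[of "max C (max B 0)"]) (auto simp: le_max_iff_disj intro: lipschitz_on_mono)
qed

lemma bounded_lipschitz_on_bilinear: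
  assumes "bounded_bilinear mul" and f: "bounded_lipschitz_on S f" and g: "bounded_lipschitz_on S g"
  shows "bounded_lipschitz_on S (\<lambda>z. mul (f z) (g z))"
proof -
  interpret bounded_bilinear mul by fact
  obtain K where K: "0 \<le> K" "\<And>a b. norm (mul a b) \<le> norm a * norm b * K"
    using nonneg_bounded by blast
  obtain A where A: "0 \<le> A" "A-lipschitz_on S f" "\<And>z. z \<in> S \<Longrightarrow> norm (f z) \<le> A"
    using bounded_lipschitz_onE[OF f] by blast
  obtain B where B: "0 \<le> B" "B-lipschitz_on S g" "\<And>z. z \<in> S \<Longrightarrow> norm (g z) \<le> B"
    using bounded_lipschitz_onE[OF g] by blast
  have "(2 * A * B * K)-lipschitz_on S (\<lambda>z. mul (f z) (g z))"
  proof (rule lipschitz_onI)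
    fix y z assume S: "y \<in> S" "z \<in> S"
    have "mul (f y) (g y) - mul (f z) (g z) = mul (f y - f z) (g y) + mul (f z) (g y - g z)"
      by (simp add: diff_left diff_right)
    also have "norm \<dots> \<le> norm (f y - f z) * norm (g y) * K + norm (f z) * norm (g y - g z) * K"
      by (rule order_trans[OF norm_triangle_ineq add_mono[OF K(2) K(2)]])
    also have "\<dots> \<le> (A * dist y z) * B * K + A * (B * dist y z) * K"
      using S A B K lipschitz_onD[OF A(2) S] lipschitz_onD[OF B(2) S]
      by (intro add_mono mult_mono) (auto simp: dist_norm)
    finally show "dist (mul (f y) (g y)) (mul (f z) (g z)) \<le> 2 * A * B * K * dist y z"
      by (simp add: dist_norm algebra_simps)
  qed (use A B K in auto)
  moreover have "norm (mul (f z) (g z)) \<le> A * B * K" if "z \<in> S" for z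
    by (rule order_trans[OF K(2)]) (use that A B K in \<open>auto intro!: mult_mono\<close>)
  ultimately show ?thesis unfolding bounded_lipschitz_on_def by (auto intro!: boundedI)
qed

lemmas bounded_lipschitz_on_inner = bounded_lipschitz_on_bilinear[OF bounded_bilinear_inner]
  and bounded_lipschitz_on_scaleR = bounded_lipschitz_on_bilinear[OF bounded_bilinear_scaleR]

lemma bounded_lipschitz_on_const: "bounded_lipschitz_on S (\<lambda>z. c)"
  unfolding bounded_lipschitz_on_def by (auto intro!: lipschitz_intros boundedI[of _ "norm c"])

lemma bounded_lipschitz_on_diff:
  assumes "bounded_lipschitz_on S f" "bounded_lipschitz_on S g"
  shows "bounded_lipschitz_on S (\<lambda>z. f z - g z)"
  using assms unfolding bounded_lipschitz_on_def
  by (auto intro!: lipschitz_intros bounded_minus_comp)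

lemma bounded_lipschitz_on_fst:
  "bounded S \<Longrightarrow> bounded_lipschitz_on S (fst :: 'a::real_normed_vector \<times> 'b::real_normed_vector \<Rightarrow> 'a)"
  unfolding bounded_lipschitz_on_def
  by (intro conjI impI exI[of _ 1] lipschitz_onI bounded_linear_image bounded_linear_fst) (simp_all add: dist_fst_le)

lemma bounded_lipschitz_on_snd:
  "bounded S \<Longrightarrow> bounded_lipschitz_on S (snd :: 'a::real_normed_vector \<times> 'b::real_normed_vector \<Rightarrow> 'b)"
  unfolding bounded_lipschitz_on_def
  by (intro conjI impI exI[of _ 1] lipschitz_onI bounded_linear_image bounded_linear_snd) (simp_all add: dist_snd_le)

lemma bounded_lipschitz_on_inverse_norm:
  assumes f: "bounded_lipschitz_on S f" and m: "0 < m" "\<And>z. z \<in> S \<Longrightarrow> m \<le> norm (f z)"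
  shows "bounded_lipschitz_on S (\<lambda>z. 1 / norm (f z))"
proof -
  obtain A where A: "0 \<le> A" "A-lipschitz_on S f"
    using bounded_lipschitz_onE[OF f] by blast
  have "(A / m\<^sup>2)-lipschitz_on S (\<lambda>z. 1 / norm (f z))"
  proof (rule lipschitz_onI)
    fix y z assume S: "y \<in> S" "z \<in> S"
    have pos: "0 < norm (f y)" "0 < norm (f z)" using m(1) m(2)[OF S(1)] m(2)[OF S(2)] by linarith+
    then have "dist (1 / norm (f y)) (1 / norm (f z)) = \<bar>norm (f y) - norm (f z)\<bar> / (norm (f y) * norm (f z))"
      by (simp add: dist_real_def diff_frac_eq abs_minus_commute abs_mult)
    also have "\<dots> \<le> (A * dist y z) / (m * m)"
      using lipschitz_onD[OF A(2) S] norm_triangle_ineq3[of "f y" "f z"] A m S pos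
      by (intro frac_le mult_mono) (auto simp: dist_norm)
    finally show "dist (1 / norm (f y)) (1 / norm (f z)) \<le> A / m\<^sup>2 * dist y z"
      by (simp add: power2_eq_square)
  qed (use A in auto)
  moreover have "norm (1 / norm (f z)) \<le> 1 / m" if "z \<in> S" for z
    using m(2)[OF that] m(1) by (auto intro: frac_le)
  ultimately show ?thesis unfolding bounded_lipschitz_on_def by (auto intro!: boundedI)
qed

lemma bounded_lipschitz_on_kepler_force:
  assumes S: "bounded S" and m: "0 < m" "\<And>z. z \<in> S \<Longrightarrow> m \<le> norm (fst z)"
  shows "bounded_lipschitz_on S (\<lambda>z. kepler_force (fst (z :: (real^2) \<times> (real^2))))"
proof -
  have i: "bounded_lipschitz_on S (\<lambda>z. 1 / norm (fst z))"
    by (rule bounded_lipschitz_on_inverse_norm[OF bounded_lipschitz_on_fst[OF S] m])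
  have eq: "kepler_force p = (0 - (1 / norm p) *\<^sub>R (1 / norm p) *\<^sub>R (1 / norm p) *\<^sub>R p)" for p
    by (simp add: kepler_force_def power3_eq_cube)
  show ?thesis unfolding eq
    by (intro bounded_lipschitz_on_diff bounded_lipschitz_on_const bounded_lipschitz_on_scaleR i
        bounded_lipschitz_on_fst S)
qed

text \<open>
  On a compact set, convex or not, a locally Lipschitz function is Lipschitz.
\<close>

lemma bounded_lipschitz_on_C1:
  fixes G :: "'a::euclidean_space \<times> 'b::euclidean_space \<Rightarrow> 'b"
  assumes G: "C1_differentiable U G" and U: "open U" and S: "compact S" "S \<subseteq> U"
  shows "bounded_lipschitz_on S G"
proof -
  obtain G' where G': "\<And>z. z \<in> U \<Longrightarrow> (G has_derivative blinfun_apply (G' z)) (at z)" "continuous_on U G'"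
    using G unfolding C1_differentiable_def by blast
  have cont: "continuous_on S G"
    using G'(1) S by (intro has_derivative_continuous_on) (blast intro: has_derivative_at_withinI)
  \<comment> \<open>With a zero component added, \<open>G\<close> becomes a map of the phase space into itself.\<close>
  define inj2 :: "'b \<Rightarrow> 'a \<times> 'b" where "inj2 = (\<lambda>w. (0, w))"
  have bl: "bounded_linear inj2"
    unfolding inj2_def by (intro bounded_linear_Pair bounded_linear_zero bounded_linear_ident)
  have "local_lipschitz (UNIV :: real set) U (\<lambda>_ z. inj2 (G z))"
  proof (rule c1_implies_local_lipschitz[where f' = "\<lambda>(t, z). Blinfun inj2 o\<^sub>L G' z"])
    show "((\<lambda>z. inj2 (G z)) has_derivative
        blinfun_apply (case (t, z) of (t, z) \<Rightarrow> Blinfun inj2 o\<^sub>L G' z)) (at z)"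
      if "z \<in> U" for t :: real and z
      using bounded_linear.has_derivative[OF bl G'(1)[OF that]]
      by (simp add: bounded_linear_Blinfun_apply[OF bl] o_def blinfun_compose.rep_eq)
    show "continuous_on (UNIV \<times> U) (\<lambda>(t :: real, z). Blinfun inj2 o\<^sub>L G' z)"
      unfolding case_prod_beta
      by (intro continuous_intros continuous_on_compose2[OF G'(2)]) auto
  qed (use U in auto)
  then have ll: "local_lipschitz {0 :: real} S (\<lambda>_ z. inj2 (G z))"
    using S by (auto intro: local_lipschitz_subset)
  then obtain C where C: "C-lipschitz_on S (\<lambda>z. inj2 (G z))"
    using local_lipschitz_compact_implies_lipschitz[OF ll S(1)] by auto
  have "C-lipschitz_on S G"
    using lipschitz_on_nonneg[OF C] lipschitz_onD[OF C]
    by (intro lipschitz_onI) (auto simp: inj2_def dist_Pair_Pair)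
  then show ?thesis
    using compact_imp_bounded[OF compact_continuous_image[OF cont S(1)]]
    by (auto simp: bounded_lipschitz_on_def)
qed

section \<open>The modified equation of the Stoermer-Verlet method\<close>

text \<open>
  A Taylor formula with remainder for the symmetric second difference: the function \<open>P\<close> stands for
  the expansion, and it suffices to compare second derivatives.
\<close>

lemma second_difference_bound:
  fixes Y V W P :: "real \<Rightarrow> 'a::real_normed_vector"
  assumes h: "0 \<le> h"
    and Y: "\<And>t. t \<in> {-h..h} \<Longrightarrow> (Y has_vector_derivative V t) (at t within {-h..h})"
    and V: "\<And>t. t \<in> {-h..h} \<Longrightarrow> (V has_vector_derivative W t) (at t within {-h..h})"
    and P: "\<And>t. (P has_vector_derivative P' t) (at t)" "\<And>t. (P' has_vector_derivative P'' t) (at t)"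
      "P 0 = 0" "P' 0 = 0"
    and bd: "\<And>t. t \<in> {0..h} \<Longrightarrow> norm (W t + W (- t) - P'' t) \<le> B"
  shows "norm (Y h + Y (- h) - 2 *\<^sub>R Y 0 - P h) \<le> B * h\<^sup>2"
proof -
  have neg: "((\<lambda>t. f (- t)) has_vector_derivative - f' (- t)) (at t within {0..h})"
    if f: "\<And>t. t \<in> {-h..h} \<Longrightarrow> (f has_vector_derivative f' t) (at t within {-h..h})"
      and t: "t \<in> {0..h}" for f f' :: "real \<Rightarrow> 'a" and t
  proof -
    have "(uminus has_vector_derivative (- 1 :: real)) (at t within {0..h})"
      by (auto intro!: derivative_eq_intros)
    moreover have "(f has_vector_derivative f' (- t)) (at (- t) within uminus ` {0..h})"
      by (rule has_vector_derivative_within_subset[OF f]) (use t in auto)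
    ultimately have "((f \<circ> uminus) has_vector_derivative (-1) *\<^sub>R f' (- t)) (at t within {0..h})"
      by (rule vector_diff_chain_within)
    then show ?thesis by (simp add: o_def)
  qed
  have pos: "(f has_vector_derivative f' t) (at t within {0..h})"
    if f: "\<And>t. t \<in> {-h..h} \<Longrightarrow> (f has_vector_derivative f' t) (at t within {-h..h})"
      and t: "t \<in> {0..h}" for f f' :: "real \<Rightarrow> 'a" and t
    by (rule has_vector_derivative_within_subset[OF f]) (use t in auto)
  define u where "u t = Y t + Y (- t) - 2 *\<^sub>R Y 0 - P t" for t
  define u' where "u' t = V t - V (- t) - P' t" for t
  have u: "(u has_vector_derivative u' t) (at t within {0..h})" if "t \<in> {0..h}" for t
    unfolding u_def[abs_def] u'_def
    by (auto intro!: derivative_eq_intros pos[OF Y that] neg[OF Y that] has_vector_derivative_at_within[OF P(1)])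
  have u': "(u' has_vector_derivative (W t + W (- t) - P'' t)) (at t within {0..h})" if "t \<in> {0..h}" for t
    unfolding u'_def[abs_def]
    by (auto intro!: derivative_eq_intros pos[OF V that] neg[OF V that] has_vector_derivative_at_within[OF P(2)])
  have B: "0 \<le> B" using order_trans[OF norm_ge_zero bd[of 0]] h by auto
  have "norm (u' t) \<le> B * h" if t: "t \<in> {0..h}" for t
  proof -
    have "norm (u' t - u' 0) \<le> B * (t - 0)"
      by (rule vector_derivative_bound[where f' = "\<lambda>t. W t + W (- t) - P'' t"])
        (use t bd in \<open>auto intro!: has_vector_derivative_within_subset[OF u']\<close>)
    also have "\<dots> \<le> B * h" using t B by (intro mult_left_mono) auto
    finally show ?thesis using P(4) by (simp add: u'_def)
  qed
  then have "norm (u h - u 0) \<le> (B * h) * (h - 0)"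
    by (intro vector_derivative_bound[OF h u]) auto
  moreover have "u 0 = 0" using P(3) by (simp add: u_def scaleR_2)
  ultimately have "norm (u h) \<le> B * h\<^sup>2" by (simp add: power2_eq_square mult.assoc)
  then show ?thesis by (simp add: u_def)
qed

text \<open>
  The modified equation as a first-order system on phase space; for \<open>h = 0\<close> it is the Kepler flow.
\<close>

definition modified_field :: "(real^2 \<Rightarrow> real^2 \<Rightarrow> real^2) \<Rightarrow> real \<Rightarrow> (real^2) \<times> (real^2) \<Rightarrow> (real^2) \<times> (real^2)" where
  "modified_field g h z = (snd z, truncated_modified_force kepler_force g h (fst z) (snd z))"

lemma compact_avoids_origin:
  fixes S :: "((real^2) \<times> (real^2)) set"
  assumes "compact S" "S \<subseteq> (- {0}) \<times> UNIV"
  obtains m where "0 < m" "\<And>z. z \<in> S \<Longrightarrow> m \<le> norm (fst z)"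
proof (cases "S = {}")
  case False
  have "continuous_on S (\<lambda>z. norm (fst z))" by (intro continuous_intros)
  then obtain w where "w \<in> S" "\<And>z. z \<in> S \<Longrightarrow> norm (fst w) \<le> norm (fst z)"
    using continuous_attains_inf[OF assms(1) False] by blast
  then show thesis using assms(2) by (intro that[of "norm (fst w)"]) auto
qed (use that[of 1] in auto)

lemma bounded_lipschitz_on_forces:
  fixes g :: "real^2 \<Rightarrow> real^2 \<Rightarrow> real^2"
  assumes g: "C1_differentiable ((- {0}) \<times> UNIV) (\<lambda>(x, v). g x v)"
    and S: "compact S" "S \<subseteq> (- {0}) \<times> (UNIV :: (real^2) set)"
  shows "bounded_lipschitz_on S (\<lambda>z :: (real^2) \<times> (real^2). kepler_force (fst z))"
    and "bounded_lipschitz_on S (\<lambda>z. g (fst z) (snd z))"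
proof -
  obtain m where m: "0 < m" "\<And>z. z \<in> S \<Longrightarrow> m \<le> norm (fst z)"
    using compact_avoids_origin[OF S] by blast
  show "bounded_lipschitz_on S (\<lambda>z :: (real^2) \<times> (real^2). kepler_force (fst z))"
    by (rule bounded_lipschitz_on_kepler_force[OF compact_imp_bounded[OF S(1)] m])
  show "bounded_lipschitz_on S (\<lambda>z. g (fst z) (snd z))"
    using bounded_lipschitz_on_C1[OF g open_Times S] by (simp add: case_prod_beta' open_Compl)
qed

lemma modified_field_bounds:
  fixes g :: "real^2 \<Rightarrow> real^2 \<Rightarrow> real^2"
  assumes g: "C1_differentiable ((- {0}) \<times> UNIV) (\<lambda>(x, v). g x v)"
    and S: "compact S" "S \<subseteq> (- {0}) \<times> (UNIV :: (real^2) set)"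
  obtains C where "0 \<le> C" "\<And>h. h \<in> {0..1} \<Longrightarrow> C-lipschitz_on S (modified_field g h)"
    "\<And>h z. h \<in> {0..1} \<Longrightarrow> z \<in> S \<Longrightarrow> norm (modified_field g h z) \<le> C"
proof -
  obtain A where A: "0 \<le> A" "A-lipschitz_on S (\<lambda>z. kepler_force (fst z))"
      "\<And>z. z \<in> S \<Longrightarrow> norm (kepler_force (fst z)) \<le> A"
    using bounded_lipschitz_onE[OF bounded_lipschitz_on_forces(1)[OF g S]] by blast
  obtain B where B: "0 \<le> B" "B-lipschitz_on S (\<lambda>z. g (fst z) (snd z))"
      "\<And>z. z \<in> S \<Longrightarrow> norm (g (fst z) (snd z)) \<le> B"
    using bounded_lipschitz_onE[OF bounded_lipschitz_on_forces(2)[OF g S]] by blast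
  obtain D where D: "0 \<le> D" "\<And>z. z \<in> S \<Longrightarrow> norm (snd z) \<le> D"
    using bounded_lipschitz_onE[OF bounded_lipschitz_on_snd[OF compact_imp_bounded[OF S(1)]]] by blast
  show thesis
  proof (rule that[of "1 + A + B + D"])
    fix h :: real assume h: "h \<in> {0..1}"
    then have h2: "norm (h\<^sup>2 *\<^sub>R a) \<le> norm a" for a :: "real^2"
      by (simp add: mult_left_le_one_le power_le_one)
    show "(1 + A + B + D)-lipschitz_on S (modified_field g h)"
    proof (rule lipschitz_onI)
      fix y z assume S: "y \<in> S" "z \<in> S"
      let ?G = "\<lambda>z. g (fst z) (snd z)" and ?f = "\<lambda>z. kepler_force (fst z)"
      have "norm (modified_field g h y - modified_field g h z)
          \<le> norm (snd y - snd z) + norm ((?f y - ?f z) + h\<^sup>2 *\<^sub>R (?G y - ?G z))"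
        by (rule order_trans[OF _ norm_Pair_le])
          (simp add: modified_field_def truncated_modified_force_def algebra_simps)
      also have "\<dots> \<le> dist y z + (A * dist y z + B * dist y z)"
        using lipschitz_onD[OF A(2) S] lipschitz_onD[OF B(2) S] dist_snd_le[of y z]
        by (intro add_mono norm_triangle_le order_trans[OF h2]) (auto simp: dist_norm)
      also have "\<dots> \<le> (1 + A + B + D) * dist y z" using D by (simp add: algebra_simps)
      finally show "dist (modified_field g h y) (modified_field g h z) \<le> (1 + A + B + D) * dist y z"
        by (simp add: dist_norm)
    qed (use A B D in auto)
    fix z assume z: "z \<in> S"
    have "norm (modified_field g h z) \<le> norm (snd z) + norm (kepler_force (fst z) + h\<^sup>2 *\<^sub>R g (fst z) (snd z))"
      unfolding modified_field_def truncated_modified_force_def by (rule norm_Pair_le)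
    also have "\<dots> \<le> D + (A + B)"
      using A(3)[OF z] B(3)[OF z] D(2)[OF z]
      by (intro add_mono norm_triangle_le order_trans[OF h2]) auto
    finally show "norm (modified_field g h z) \<le> 1 + A + B + D" by simp
  qed (use A B D in auto)
qed

lemma fst_snd_has_vector_derivative:
  assumes "(z has_vector_derivative d) F"
  shows "((\<lambda>t. fst (z t)) has_vector_derivative fst d) F" "((\<lambda>t. snd (z t)) has_vector_derivative snd d) F"
  using bounded_linear.has_vector_derivative[OF bounded_linear_fst assms]
    bounded_linear.has_vector_derivative[OF bounded_linear_snd assms] by auto

lemma solves_modified_fieldI:
  assumes "\<And>t. t \<in> I \<Longrightarrow> (z has_vector_derivative modified_field g h (z t)) (at t within I)"
    and "\<And>t. t \<in> I \<Longrightarrow> fst (z t) \<noteq> 0"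
  shows "solves_second_order (truncated_modified_force kepler_force g h) (- {0}) 0 I
    (\<lambda>t. fst (z t)) (\<lambda>t. snd (z t))"
  unfolding solves_second_order_def
proof (intro ballI conjI)
  fix t assume t: "t \<in> I"
  show "fst (z t) \<in> - {0}" using assms(2)[OF t] by simp
  show "((\<lambda>t. fst (z t)) has_vector_derivative snd (z t)) (at t within I)"
    using fst_snd_has_vector_derivative(1)[OF assms(1)[OF t]] by (simp add: modified_field_def)
  show "\<exists>w. ((\<lambda>t. snd (z t)) has_vector_derivative w) (at t within I) \<and>
      norm (w - truncated_modified_force kepler_force g h (fst (z t)) (snd (z t))) \<le> 0"
    using fst_snd_has_vector_derivative(2)[OF assms(1)[OF t]] by (auto simp: modified_field_def)
qed

lemma continuous_force_second_derivative:
  fixes G :: "(real^2) \<times> (real^2) \<Rightarrow> real^2"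
  assumes p: "p \<noteq> 0" and G: "continuous (at (p, q)) G"
  shows "((\<lambda>(h :: real, z). kepler_force_deriv2 (fst z) (snd z) (kepler_force (fst z) + h\<^sup>2 *\<^sub>R G z))
    \<longlongrightarrow> kepler_force_deriv2 p q (kepler_force p)) (nhds (0, (p, q)))"
proof -
  have "(G \<longlongrightarrow> G (p, q)) (nhds (p, q))"
    using G by (simp add: continuous_within tendsto_nhds_iff)
  moreover have "((\<lambda>w. snd w) \<longlongrightarrow> (p, q)) (nhds (0 :: real, (p, q)))"
    using tendsto_snd[OF filterlim_ident[of "nhds (0 :: real, (p, q))"]] by simp
  ultimately have "((\<lambda>w. G (snd w)) \<longlongrightarrow> G (p, q)) (nhds (0 :: real, (p, q)))"
    by (rule filterlim_compose)
  note [tendsto_intros] = this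
  have "((\<lambda>w :: real \<times> (real^2) \<times> (real^2). kepler_force_deriv2 (fst (snd w)) (snd (snd w))
      (kepler_force (fst (snd w)) + (fst w)\<^sup>2 *\<^sub>R G (snd w)))
    \<longlongrightarrow> kepler_force_deriv2 (fst (snd (0 :: real, p, q))) (snd (snd (0 :: real, p, q)))
      (kepler_force (fst (snd (0 :: real, p, q))) + (fst (0 :: real, p, q))\<^sup>2 *\<^sub>R G (p, q))) (nhds (0, (p, q)))"
    unfolding kepler_force_deriv2_def kepler_force_deriv_def kepler_force_def
    using p by (intro tendsto_intros filterlim_ident) auto
  then show ?thesis by (simp add: case_prod_beta')
qed

text \<open>
  Sample a solution through \<open>(p, q)\<close> at \<open>-h, 0, h\<close>. On a time scale \<open>h\<close> the force has the expansion
  \<open>f(y(t)) + f(y(-t)) = 2 f(p) + t\<^sup>2 D + o(h\<^sup>2)\<close>, where \<open>D\<close> is its second derivative along the Kepler flow.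
  Integrating twice shows that the residual of the scheme is \<open>h\<^sup>2 (g(p, q) + D / 12) + o(h\<^sup>2)\<close>. It is
  \<open>O(h\<^sup>4)\<close> by assumption, so the bracket vanishes.
\<close>

lemma verlet_modified_term_unique:
  assumes modified: "verlet_modified_term kepler_force (- {0}) g" and p: "p \<noteq> 0"
  shows "g p q = kepler_verlet_term p q"
proof -
  let ?G = "\<lambda>z. g (fst z) (snd z)"
  have g: "C1_differentiable ((- {0}) \<times> UNIV) (\<lambda>(x, v). g x v)"
    using modified by (simp add: verlet_modified_term_def)
  define c where "c = (p, q)"
  define \<delta> where "\<delta> = norm p / 2"
  have \<delta>: "0 < \<delta>" using p by (simp add: \<delta>_def)
  have avoids: "z \<in> (- {0}) \<times> UNIV" if "z \<in> cball c \<delta>" for z :: "(real^2) \<times> (real^2)"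
  proof -
    have "dist p (fst z) \<le> \<delta>" using that dist_fst_le[of c z] by (simp add: c_def)
    then have "fst z \<noteq> 0" using p by (auto simp: \<delta>_def)
    then show ?thesis by (cases z) auto
  qed
  then have sub: "cball c \<delta> \<subseteq> (- {0}) \<times> UNIV" by blast
  obtain C where C: "0 \<le> C" "\<And>h. h \<in> {0..1} \<Longrightarrow> C-lipschitz_on (cball c \<delta>) (modified_field g h)"
    "\<And>h z. h \<in> {0..1} \<Longrightarrow> z \<in> cball c \<delta> \<Longrightarrow> norm (modified_field g h z) \<le> C"
    using modified_field_bounds[OF g compact_cball sub] by blast
  define d where "d = min 1 (\<delta> / (C + 1))"
  have d: "0 < d" "d \<le> 1" using \<delta> C by (auto simp: d_def)
  have fits: "C * h \<le> \<delta>" if "h \<in> {0..d}" for h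
  proof -
    have "C * h \<le> (C + 1) * (\<delta> / (C + 1))"
      using that C by (intro mult_mono) (auto simp: d_def)
    then show ?thesis using C by simp
  qed
  have "\<exists>z. z 0 = c \<and> (\<forall>t\<in>{-h..h}. norm (z t - c) \<le> C * \<bar>t\<bar> \<and>
      (z has_vector_derivative modified_field g h (z t)) (at t within {-h..h}))" if h: "h \<in> {0<..d}" for h
  proof -
    have h': "h \<in> {0..1}" "h \<in> {0..d}" using h d by auto
    show ?thesis
      using local_flow[OF C(2)[OF h'(1)] C(3)[OF h'(1)] _ fits[OF h'(2)] less_imp_le[OF \<delta>]] h'
      by (metis atLeastAtMost_iff)
  qed
  then obtain Z where Z: "\<And>h. h \<in> {0<..d} \<Longrightarrow> Z h 0 = c"
    "\<And>h t. h \<in> {0<..d} \<Longrightarrow> t \<in> {-h..h} \<Longrightarrow> norm (Z h t - c) \<le> C * \<bar>t\<bar>"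
    "\<And>h t. h \<in> {0<..d} \<Longrightarrow> t \<in> {-h..h} \<Longrightarrow>
      (Z h has_vector_derivative modified_field g h (Z h t)) (at t within {-h..h})"
    by metis
  define Y where "Y h t = fst (Z h t)" for h t
  define V where "V h t = snd (Z h t)" for h t
  have inball: "Z h t \<in> cball c \<delta>" if "h \<in> {0<..d}" "t \<in> {-h..h}" for h t
  proof -
    have "C * \<bar>t\<bar> \<le> C * h" using that C by (intro mult_left_mono) auto
    then show ?thesis using Z(2)[OF that] fits[of h] that by (auto simp: dist_norm norm_minus_commute)
  qed
  have Ynz: "Y h t \<noteq> 0" if "h \<in> {0<..d}" "t \<in> {-h..h}" for h t
    using avoids[OF inball[OF that]] by (auto simp: Y_def mem_Times_iff)
  have ev_d: "\<forall>\<^sub>F h in at_right 0. h \<in> {0<..d}"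
    using d by (auto simp: eventually_at_right_field intro!: exI[of _ d])
  have "\<forall>\<^sub>F h in at_right 0. solves_second_order (truncated_modified_force kepler_force g h) (- {0}) 0
      {-h..h} (Y h) (V h) \<and> Y h 0 = p \<and> V h 0 = q"
    using ev_d
  proof eventually_elim
    case (elim h)
    have "solves_second_order (truncated_modified_force kepler_force g h) (- {0}) 0 {-h..h} (Y h) (V h)"
      unfolding Y_def[abs_def] V_def[abs_def]
      by (rule solves_modified_fieldI) (use elim Z(3) Ynz in \<open>auto simp: Y_def\<close>)
    then show ?case using Z(1)[OF elim] by (simp add: Y_def V_def c_def)
  qed
  then have "(\<lambda>h. norm (verlet_residual kepler_force h (Y h (-h)) (Y h 0) (Y h h))) \<in> O[at_right 0](\<lambda>h. h ^ 4)"
    using modified p unfolding verlet_modified_term_def by blast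
  then obtain k where k: "0 < k" "\<forall>\<^sub>F h in at_right 0.
      norm (verlet_residual kepler_force h (Y h (-h)) (Y h 0) (Y h h)) \<le> k * h ^ 4"
    by (auto elim!: landau_o.bigE)
  define D where "D = kepler_force_deriv2 p q (kepler_force p)"
  define \<Theta> where "\<Theta> h z = kepler_force_deriv2 (fst z) (snd z) (kepler_force (fst z) + h\<^sup>2 *\<^sub>R ?G z)" for h :: real and z
  have contG: "continuous (at c) ?G"
  proof -
    have "(\<lambda>(x, v). g x v) differentiable (at c)"
      using g p unfolding C1_differentiable_def differentiable_def c_def by blast
    then show ?thesis
      using differentiable_imp_continuous_within by (simp add: case_prod_beta')
  qed
  have small: "norm (?G c + (1 / 12) *\<^sub>R D) \<le> 5 * \<epsilon>" if \<epsilon>: "0 < \<epsilon>" for \<epsilon>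
  proof -
    have "((\<lambda>(h, z). \<Theta> h z) \<longlongrightarrow> D) (nhds (0, c))"
      using continuous_force_second_derivative[OF p contG[unfolded c_def]] by (simp add: \<Theta>_def D_def c_def)
    then have "\<forall>\<^sub>F w in nhds (0, c). dist ((\<lambda>(h, z). \<Theta> h z) w) D < \<epsilon>"
      using \<epsilon> by (rule tendstoD)
    then obtain \<rho>1 where \<rho>1: "0 < \<rho>1" "\<And>w. dist w (0, c) < \<rho>1 \<Longrightarrow> dist ((\<lambda>(h, z). \<Theta> h z) w) D < \<epsilon>"
      unfolding eventually_nhds_metric by blast
    obtain \<rho>2 where \<rho>2: "0 < \<rho>2" "\<And>z. dist z c < \<rho>2 \<Longrightarrow> dist (?G z) (?G c) < \<epsilon>"
      using contG[unfolded continuous_at_eps_delta] \<epsilon> by blast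
    \<comment> \<open>The first bound keeps \<open>(h, Z h t)\<close> near \<open>(0, c)\<close>, the second makes \<open>k h\<^sup>2 \<le> \<epsilon>\<close>.\<close>
    define r where "r = min (min \<rho>1 \<rho>2 / (C + 2)) (sqrt (\<epsilon> / k))"
    have r: "0 < r" using \<rho>1 \<rho>2 C \<epsilon> k by (auto simp: r_def intro: divide_pos_pos)
    have "\<forall>\<^sub>F h in at_right 0. h < r"
      using r by (auto simp: eventually_at_right_field intro!: exI[of _ r])
    then have "\<forall>\<^sub>F h in at_right 0. h < r \<and> h \<in> {0<..d} \<and>
        norm (verlet_residual kepler_force h (Y h (-h)) (Y h 0) (Y h h)) \<le> k * h ^ 4"
      using ev_d k(2) by eventually_elim simp
    then obtain h where elim: "h < r" "h \<in> {0<..d}"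
        "norm (verlet_residual kepler_force h (Y h (-h)) (Y h 0) (Y h h)) \<le> k * h ^ 4"
      using eventually_happens'[OF trivial_limit_at_right_real] by blast
      have h: "0 < h" "h \<in> {0<..d}" using elim by auto
      have near: "norm (\<Theta> h (Z h t) - D) \<le> \<epsilon>" "norm (?G (Z h t) - ?G c) \<le> \<epsilon>" if t: "t \<in> {-h..h}" for t
      proof -
        have "C * \<bar>t\<bar> \<le> C * h" using t C by (intro mult_left_mono) auto
        then have Zc: "norm (Z h t - c) \<le> C * h" using Z(2)[OF h(2) t] by simp
        have "h < min \<rho>1 \<rho>2 / (C + 2)" using elim(1) by (simp add: r_def)
        then have "h * (C + 2) < min \<rho>1 \<rho>2" using C(1) by (subst (asm) pos_less_divide_eq) auto
        then have lt: "C * h + h < min \<rho>1 \<rho>2" using h(1) unfolding distrib_left mult.commute[of h C] by linarith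
        have "dist (h, Z h t) (0, c) \<le> norm h + norm (Z h t - c)"
          using norm_Pair_le[of h "Z h t - c"] by (simp add: dist_norm)
        also have "\<dots> < \<rho>1" using Zc lt h by simp
        finally show "norm (\<Theta> h (Z h t) - D) \<le> \<epsilon>"
          using \<rho>1(2)[of "(h, Z h t)"] by (simp add: dist_norm)
        show "norm (?G (Z h t) - ?G c) \<le> \<epsilon>"
          using \<rho>2(2)[of "Z h t"] Zc lt h by (simp add: dist_norm)
      qed
      have dZ: "(Y h has_vector_derivative V h t) (at t within {-h..h})"
        "(V h has_vector_derivative (kepler_force (Y h t) + h\<^sup>2 *\<^sub>R ?G (Z h t))) (at t within {-h..h})"
        if "t \<in> {-h..h}" for t
        using fst_snd_has_vector_derivative[OF Z(3)[OF h(2) that]]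
        by (simp_all add: Y_def[abs_def] V_def[abs_def] modified_field_def truncated_modified_force_def)
      have force: "norm (kepler_force (Y h s) + kepler_force (Y h (- s)) - 2 *\<^sub>R kepler_force p - s\<^sup>2 *\<^sub>R D) \<le> (2 * \<epsilon>) * s\<^sup>2"
        if s: "s \<in> {0..h}" for s
      proof -
        have "norm (kepler_force (Y h s) + kepler_force (Y h (- s)) - 2 *\<^sub>R kepler_force (Y h 0) - s\<^sup>2 *\<^sub>R D) \<le> (2 * \<epsilon>) * s\<^sup>2"
        proof (rule second_difference_bound[where V = "\<lambda>t. kepler_force_deriv (Y h t) (V h t)"
              and W = "\<lambda>t. \<Theta> h (Z h t)" and P' = "\<lambda>t. (2 * t) *\<^sub>R D" and P'' = "\<lambda>t. 2 *\<^sub>R D"])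
          fix t assume t: "t \<in> {-s..s}"
          then have th: "t \<in> {-h..h}" using s by auto
          have sub: "{-s..s} \<subseteq> {-h..h}" using s by auto
          show "((\<lambda>t. kepler_force (Y h t)) has_vector_derivative kepler_force_deriv (Y h t) (V h t)) (at t within {-s..s})"
            by (rule has_vector_derivative_within_subset[OF kepler_force_along_curve[OF dZ(1)[OF th] Ynz[OF h(2) th]] sub])
          show "((\<lambda>t. kepler_force_deriv (Y h t) (V h t)) has_vector_derivative \<Theta> h (Z h t)) (at t within {-s..s})"
            using has_vector_derivative_within_subset[OF kepler_force_deriv_along_curve[OF dZ[OF th] Ynz[OF h(2) th]] sub]
            by (simp add: \<Theta>_def Y_def V_def)
        next
          fix t assume "t \<in> {0..s}"
          then have t: "t \<in> {-h..h}" "- t \<in> {-h..h}" using s by auto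
          have "\<Theta> h (Z h t) + \<Theta> h (Z h (- t)) - 2 *\<^sub>R D = (\<Theta> h (Z h t) - D) + (\<Theta> h (Z h (- t)) - D)"
            by (simp add: scaleR_2)
          also have "norm \<dots> \<le> \<epsilon> + \<epsilon>"
            by (intro norm_triangle_le add_mono near t)
          finally show "norm (\<Theta> h (Z h t) + \<Theta> h (Z h (- t)) - 2 *\<^sub>R D) \<le> 2 * \<epsilon>" by simp
        qed (use s in \<open>auto intro!: derivative_eq_intros\<close>)
        then show ?thesis using Z(1)[OF h(2)] by (simp add: Y_def c_def)
      qed
      define E where "E = kepler_force p + h\<^sup>2 *\<^sub>R ?G c"
      have "norm (Y h h + Y h (- h) - 2 *\<^sub>R Y h 0 - (h\<^sup>2 *\<^sub>R E + (h ^ 4 / 12) *\<^sub>R D)) \<le> (4 * \<epsilon> * h\<^sup>2) * h\<^sup>2"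
      proof (rule second_difference_bound[where V = "V h"
              and W = "\<lambda>t. kepler_force (Y h t) + h\<^sup>2 *\<^sub>R ?G (Z h t)"
              and P' = "\<lambda>t. (2 * t) *\<^sub>R E + (t ^ 3 / 3) *\<^sub>R D" and P'' = "\<lambda>t. 2 *\<^sub>R E + t\<^sup>2 *\<^sub>R D"])
        fix t assume t0: "t \<in> {0..h}"
        then have t: "t \<in> {-h..h}" "- t \<in> {-h..h}" by auto
        have "kepler_force (Y h t) + h\<^sup>2 *\<^sub>R ?G (Z h t) + (kepler_force (Y h (- t)) + h\<^sup>2 *\<^sub>R ?G (Z h (- t))) - (2 *\<^sub>R E + t\<^sup>2 *\<^sub>R D)
          = (kepler_force (Y h t) + kepler_force (Y h (- t)) - 2 *\<^sub>R kepler_force p - t\<^sup>2 *\<^sub>R D)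
            + h\<^sup>2 *\<^sub>R ((?G (Z h t) - ?G c) + (?G (Z h (- t)) - ?G c))"
          by (simp add: E_def vec_eq_iff algebra_simps)
        also have "norm \<dots> \<le> (2 * \<epsilon>) * t\<^sup>2 + h\<^sup>2 * (\<epsilon> + \<epsilon>)"
        proof (intro norm_triangle_le add_mono force t0)
          have "norm ((?G (Z h t) - ?G c) + (?G (Z h (- t)) - ?G c)) \<le> \<epsilon> + \<epsilon>"
            by (intro norm_triangle_le add_mono near t)
          from mult_left_mono[OF this zero_le_power2[of h]]
          show "norm (h\<^sup>2 *\<^sub>R ((?G (Z h t) - ?G c) + (?G (Z h (- t)) - ?G c))) \<le> h\<^sup>2 * (\<epsilon> + \<epsilon>)"
            unfolding norm_scaleR by simp
        qed
        also have "\<dots> \<le> (2 * \<epsilon>) * h\<^sup>2 + h\<^sup>2 * (\<epsilon> + \<epsilon>)"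
          using t0 \<epsilon> by (intro add_mono mult_left_mono power_mono) auto
        finally show "norm (kepler_force (Y h t) + h\<^sup>2 *\<^sub>R ?G (Z h t) + (kepler_force (Y h (- t)) + h\<^sup>2 *\<^sub>R ?G (Z h (- t)))
          - (2 *\<^sub>R E + t\<^sup>2 *\<^sub>R D)) \<le> 4 * \<epsilon> * h\<^sup>2" by (simp add: algebra_simps)
      qed (use h dZ in \<open>auto intro!: derivative_eq_intros simp: power3_eq_cube power2_eq_square\<close>)
      moreover have "Y h 0 = p" using Z(1)[OF h(2)] by (simp add: Y_def c_def)
      moreover define R where "R = verlet_residual kepler_force h (Y h (-h)) (Y h 0) (Y h h)"
      moreover have "Y h h + Y h (- h) - 2 *\<^sub>R Y h 0 = h\<^sup>2 *\<^sub>R (R + kepler_force (Y h 0))"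
        using h by (simp add: R_def verlet_residual_def algebra_simps)
      ultimately have "norm (h\<^sup>2 *\<^sub>R (R - h\<^sup>2 *\<^sub>R (?G c + (1 / 12) *\<^sub>R D))) \<le> (4 * \<epsilon> * h\<^sup>2) * h\<^sup>2"
        by (simp add: E_def algebra_simps flip: power_add)
      then have "norm (R - h\<^sup>2 *\<^sub>R (?G c + (1 / 12) *\<^sub>R D)) \<le> 4 * \<epsilon> * h\<^sup>2"
        using h mult_le_cancel_left_pos[of "h\<^sup>2"]
        by (simp only: norm_scaleR abs_power2 mult.commute[of "4 * \<epsilon> * h\<^sup>2" "h\<^sup>2"]) simp
      then have "norm (h\<^sup>2 *\<^sub>R (?G c + (1 / 12) *\<^sub>R D)) \<le> 4 * \<epsilon> * h\<^sup>2 + norm R"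
        using norm_triangle_sub[of "h\<^sup>2 *\<^sub>R (?G c + (1 / 12) *\<^sub>R D)" R]
          norm_minus_commute[of R "h\<^sup>2 *\<^sub>R (?G c + (1 / 12) *\<^sub>R D)"] by linarith
      also have "\<dots> \<le> 4 * \<epsilon> * h\<^sup>2 + (k * h\<^sup>2) * h\<^sup>2"
        using elim(3) by (simp add: R_def mult.assoc flip: power_add)
      also have "\<dots> \<le> 4 * \<epsilon> * h\<^sup>2 + \<epsilon> * h\<^sup>2"
      proof (intro add_left_mono mult_right_mono)
        have "h\<^sup>2 \<le> (sqrt (\<epsilon> / k))\<^sup>2" using elim(1) h by (intro power_mono) (auto simp: r_def)
        then show "k * h\<^sup>2 \<le> \<epsilon>" using k \<epsilon> by (simp add: field_simps)
      qed simp
      also have "\<dots> = h\<^sup>2 * (5 * \<epsilon>)" by simp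
      finally have "h\<^sup>2 * norm (?G c + (1 / 12) *\<^sub>R D) \<le> h\<^sup>2 * (5 * \<epsilon>)"
        unfolding norm_scaleR by simp
      then show ?thesis using h by simp
  qed
  have "norm (?G c + (1 / 12) *\<^sub>R D) \<le> 0"
  proof (rule field_le_epsilon)
    fix \<epsilon> :: real assume "0 < \<epsilon>"
    then show "norm (?G c + (1 / 12) *\<^sub>R D) \<le> 0 + \<epsilon>" using small[of "\<epsilon> / 5"] by simp
  qed
  then show ?thesis by (simp add: kepler_verlet_term_def D_def c_def eq_neg_iff_add_eq_0)
qed

section \<open>The geometry of a Kepler orbit\<close>

definition kepler_solution :: "(real \<Rightarrow> real^2) \<Rightarrow> (real \<Rightarrow> real^2) \<Rightarrow> bool" where
  "kepler_solution x v \<longleftrightarrow> (\<forall>t. x t \<noteq> 0 \<and> (x has_vector_derivative v t) (at t) \<and>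
     (v has_vector_derivative kepler_force (x t)) (at t))"

lemma kepler_solutionD:
  assumes "kepler_solution x v"
  shows "x t \<noteq> 0" "(x has_vector_derivative v t) (at t within I)"
    "(v has_vector_derivative kepler_force (x t)) (at t within I)"
    "((\<lambda>t. (x t, v t)) has_vector_derivative modified_field g 0 (x t, v t)) (at t within I)"
proof -
  show "x t \<noteq> 0" using assms by (simp add: kepler_solution_def)
  have "(x has_vector_derivative v t) (at t)" "(v has_vector_derivative kepler_force (x t)) (at t)"
    using assms by (simp_all add: kepler_solution_def)
  then show x: "(x has_vector_derivative v t) (at t within I)"
    and v: "(v has_vector_derivative kepler_force (x t)) (at t within I)"
    by (auto intro: has_vector_derivative_at_within)
  show "((\<lambda>t. (x t, v t)) has_vector_derivative modified_field g 0 (x t, v t)) (at t within I)"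
    using has_vector_derivative_Pair[OF x v] by (simp add: modified_field_def truncated_modified_force_def)
qed

text \<open>
  A compact neighbourhood of the orbit in phase space that avoids the collision point, on which the
  forces are therefore bounded and Lipschitz.
\<close>

lemma tube_around_solution:
  assumes x: "kepler_solution x v"
  obtains N \<delta> where "compact N" "N \<subseteq> (- {0}) \<times> UNIV" "0 < \<delta>"
    "\<And>t. t \<in> {0..T} \<Longrightarrow> cball (x t, v t) \<delta> \<subseteq> N"
proof -
  define K where "K = (\<lambda>t. (x t, v t)) ` {0..T}"
  have "compact K" unfolding K_def
    by (intro compact_continuous_image compact_Icc continuous_on_vector_derivative)
      (rule kepler_solutionD(4)[OF x])
  moreover have "K \<subseteq> (- {0}) \<times> UNIV" using kepler_solutionD(1)[OF x] by (auto simp: K_def)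
  ultimately obtain m where m: "0 < m" "\<And>z. z \<in> K \<Longrightarrow> m \<le> norm (fst z)"
    using compact_avoids_origin by blast
  define N where "N = {w + u |w u. w \<in> K \<and> u \<in> cball 0 (m / 2)}"
  show thesis
  proof (rule that[of N "m / 2"])
    show "compact N" unfolding N_def by (intro compact_sums \<open>compact K\<close> compact_cball)
    show "N \<subseteq> (- {0}) \<times> UNIV"
    proof
      fix z assume "z \<in> N"
      then obtain w u where "z = w + u" "w \<in> K" "norm u \<le> m / 2" by (auto simp: N_def)
      moreover have "norm (fst u) \<le> norm u" by (metis norm_fst_le prod.collapse)
      ultimately have "norm (fst u) < norm (fst w)" "fst z = fst w - (- fst u)"
        using m(1) m(2)[of w] by auto
      then have "fst z \<noteq> 0" by (metis eq_iff_diff_eq_0 less_irrefl norm_minus_cancel)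
      then show "z \<in> (- {0}) \<times> UNIV" by (cases z) auto
    qed
    show "cball (x t, v t) (m / 2) \<subseteq> N" if "t \<in> {0..T}" for t
    proof
      fix z assume "z \<in> cball (x t, v t) (m / 2)"
      then have "z = (x t, v t) + (z - (x t, v t))" "z - (x t, v t) \<in> cball 0 (m / 2)"
        by (auto simp: dist_norm norm_minus_commute)
      then show "z \<in> N" using that unfolding N_def K_def by blast
    qed
  qed (use m in simp)
qed

lemma C1_differentiable_zero: "C1_differentiable U (\<lambda>(x, v). 0)"
  unfolding C1_differentiable_def by (intro exI[of _ "\<lambda>_. 0"]) (auto simp: case_prod_beta' zero_blinfun.rep_eq)

lemma kepler_solution_unique:
  assumes x: "kepler_solution x v" and y: "kepler_solution y w"
    and init: "y 0 = x 0" "w 0 = v 0" and t: "0 \<le> t"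
  shows "y t = x t"
proof -
  obtain N \<delta> where N: "compact N" "N \<subseteq> (- {0}) \<times> UNIV" "0 < \<delta>"
    "\<And>s. s \<in> {0..t} \<Longrightarrow> cball (x s, v s) \<delta> \<subseteq> N"
    using tube_around_solution[OF x] by blast
  obtain C where C: "C-lipschitz_on N (modified_field (\<lambda>_ _. 0) 0)"
    using modified_field_bounds[OF C1_differentiable_zero N(1,2)] by (metis atLeastAtMost_iff order_refl zero_le_one)
  have "norm ((y t, w t) - (x t, v t)) \<le> 0 * exp ((C + 1) * t)"
    by (rule solution_stability[where T = t, OF kepler_solutionD(4)[OF x] N(4) C kepler_solutionD(4)[OF y]])
      (use init N t in auto)
  then show ?thesis by (simp add: prod_eq_iff)
qed

text \<open>
  The hodograph: it shows that the velocity is determined by the direction of the position and the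
  conserved quantities.
\<close>

lemma rot_lrl_vector:
  "rot (lrl_vector p q + (1 / norm p) *\<^sub>R p) = angular_momentum p q *\<^sub>R q"
  by (simp add: lrl_vector_def angular_momentum_def vec_eq_iff forall_2 inner_2 power2_norm_eq_inner algebra_simps)

text \<open>
  The equation of the conic section in focal form. It is Lagrange's identity
  \<open>|p|\<^sup>2 |q|\<^sup>2 - (p \<bullet> q)\<^sup>2 = (p \<times> q)\<^sup>2\<close>.
\<close>

lemma orbit_equation:
  assumes "p \<noteq> 0"
  shows "norm p + lrl_vector p q \<bullet> p = (angular_momentum p q)\<^sup>2"
proof -
  have "(1 / norm p) * (p \<bullet> p) = norm p"
    using assms by (simp add: power2_norm_eq_inner[symmetric] power2_eq_square)
  then have "norm p + lrl_vector p q \<bullet> p = (q \<bullet> q) * (p \<bullet> p) - (p \<bullet> q)\<^sup>2"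
    unfolding lrl_vector_def inner_diff_left inner_scaleR_left power2_norm_eq_inner
    by (simp add: inner_commute power2_eq_square)
  also have "\<dots> = (angular_momentum p q)\<^sup>2"
    by (simp add: inner_2 angular_momentum_def power2_eq_square algebra_simps)
  finally show ?thesis .
qed

lemma kepler_constants:
  assumes x: "kepler_solution x v"
  shows "lrl_vector (x t) (v t) = lrl_vector (x 0) (v 0)"
    and "angular_momentum (x t) (v t) = angular_momentum (x 0) (v 0)"
proof -
  have "((\<lambda>t. lrl_vector (x t) (v t)) has_vector_derivative 0) (at s within UNIV)" for s
    using lrl_vector_along_curve[of x v s UNIV, OF kepler_solutionD(2,3,1)[OF x]]
    by (simp add: lrl_rate_def)
  then obtain a where "\<And>s. lrl_vector (x s) (v s) = a"
    using has_vector_derivative_zero_constant[of UNIV] by (metis UNIV_I convex_UNIV)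
  then show "lrl_vector (x t) (v t) = lrl_vector (x 0) (v 0)" by simp
  have "((\<lambda>t. angular_momentum (x t) (v t)) has_vector_derivative 0) (at s within UNIV)" for s
    using angular_momentum_along_curve[of x v s UNIV, OF kepler_solutionD(2,3)[OF x]]
    by (simp add: angular_momentum_def has_real_derivative_iff_has_vector_derivative)
  then obtain l where "\<And>s. angular_momentum (x s) (v s) = l"
    using has_vector_derivative_zero_constant[of UNIV] by (metis UNIV_I convex_UNIV)
  then show "angular_momentum (x t) (v t) = angular_momentum (x 0) (v 0)" by simp
qed

text \<open>
  In every direction \<open>u\<close> there is exactly one point of the ellipse, at distance
  \<open>2 b\<^sup>2 / (2 a - F \<bullet> u)\<close> from the focus at the origin. Inserting it into the other equation for all \<open>u\<close>
  determines \<open>l\<close> and \<open>A\<close>.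
\<close>

lemma ellipse_focal_equation:
  assumes E: "is_ellipse 0 F a b E" and A: "\<And>p. p \<in> E \<Longrightarrow> norm p + A \<bullet> p = l"
  shows "l = b\<^sup>2 / a" "A = - (1 / (2 * a)) *\<^sub>R F" "(norm A)\<^sup>2 = 1 - b\<^sup>2 / a\<^sup>2"
proof -
  have ab: "0 < b" "b \<le> a" "0 < a" and F: "norm F = 2 * sqrt (a\<^sup>2 - b\<^sup>2)"
    and E: "E = {p. norm p + norm (p - F) = 2 * a}"
    using E by (auto simp: is_ellipse_def dist_norm)
  have "b\<^sup>2 \<le> a\<^sup>2" using ab by (intro power_mono) auto
  then have F2: "(norm F)\<^sup>2 = 4 * a\<^sup>2 - 4 * b\<^sup>2" by (simp add: F power_mult_distrib)
  then have "(norm F)\<^sup>2 < (2 * a)\<^sup>2" using ab by (simp add: power_mult_distrib)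
  then have F_lt: "norm F < 2 * a" by (rule power2_less_imp_less) (use ab in simp)
  have polar: "2 * b\<^sup>2 * (1 + A \<bullet> u) = l * (2 * a - F \<bullet> u)" if u: "norm u = 1" for u
  proof -
    define d where "d = 2 * a - F \<bullet> u"
    define \<rho> where "\<rho> = 2 * b\<^sup>2 / d"
    have "\<bar>F \<bullet> u\<bar> \<le> norm F" using Cauchy_Schwarz_ineq2[of F u] u by simp
    then have d: "0 < 2 * a - norm F" "2 * a - norm F \<le> d" "0 < d" using F_lt by (auto simp: d_def)
    have \<rho>: "0 < \<rho>" "\<rho> * d = 2 * b\<^sup>2" using d ab by (auto simp: \<rho>_def)
    have "\<rho> \<le> 2 * b\<^sup>2 / (2 * a - norm F)"
      unfolding \<rho>_def using d by (intro divide_left_mono) auto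
    also have "\<dots> = (2 * a + norm F) / 2"
      using d F2 by (simp add: field_simps power2_eq_square)
    finally have \<rho>_le: "\<rho> \<le> 2 * a" using F_lt by simp
    have "(norm (\<rho> *\<^sub>R u - F))\<^sup>2 = \<rho>\<^sup>2 * (u \<bullet> u) - 2 * \<rho> * (F \<bullet> u) + (norm F)\<^sup>2"
      unfolding power2_norm_eq_inner
      by (simp add: inner_diff_left inner_diff_right inner_commute power2_eq_square algebra_simps)
    also have "u \<bullet> u = 1" using u by (simp add: norm_eq_1)
    also have "\<rho>\<^sup>2 * 1 - 2 * \<rho> * (F \<bullet> u) + (norm F)\<^sup>2 = (2 * a - \<rho>)\<^sup>2"
      using \<rho>(2) F2 by (simp add: d_def power2_eq_square algebra_simps)
    finally have "norm (\<rho> *\<^sub>R u - F) = 2 * a - \<rho>"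
      using \<rho>_le by (simp add: power2_eq_iff_nonneg)
    then have "\<rho> *\<^sub>R u \<in> E" using u \<rho> by (simp add: E)
    then have "\<rho> * (1 + A \<bullet> u) = l" using A[of "\<rho> *\<^sub>R u"] u \<rho> by (simp add: algebra_simps)
    then have "(\<rho> * d) * (1 + A \<bullet> u) = l * d" by (simp add: mult_ac)
    then show ?thesis unfolding \<rho>(2) unfolding d_def .
  qed
  have ax: "norm (axis i 1 :: real^2) = 1" for i :: 2 by (simp add: norm_axis_1)
  have l2: "2 * b\<^sup>2 = l * (2 * a)"
    using polar[OF ax[of 1]] polar[of "- axis 1 1"] ax[of 1] by (simp add: algebra_simps)
  then show l: "l = b\<^sup>2 / a" using ab by (simp add: field_simps)
  have l0: "l \<noteq> 0" using l ab by simp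
  have "A \<bullet> axis i 1 = - (1 / (2 * a)) * (F \<bullet> axis i 1)" for i :: 2
  proof -
    have "l * (2 * a) * (A \<bullet> axis i 1) = - l * (F \<bullet> axis i 1)"
      using polar[OF ax[of i]] by (simp add: l2 algebra_simps)
    then have "l * (2 * a * (A \<bullet> axis i 1) + F \<bullet> axis i 1) = 0" by (simp add: algebra_simps)
    then have "2 * a * (A \<bullet> axis i 1) + F \<bullet> axis i 1 = 0" using l0 by simp
    then show ?thesis using ab by (simp add: field_simps)
  qed
  then show A: "A = - (1 / (2 * a)) *\<^sub>R F" by (simp add: vec_eq_iff inner_axis)
  have "(norm A)\<^sup>2 = (norm F)\<^sup>2 / (2 * a)\<^sup>2"
    using ab by (simp add: A power_divide)
  then show "(norm A)\<^sup>2 = 1 - b\<^sup>2 / a\<^sup>2" using ab by (simp add: F2 field_simps)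
qed

lemma orthogonal_expansion:
  fixes u p :: "real^2"
  assumes "norm u = 1"
  shows "p = (u \<bullet> p) *\<^sub>R u + (rot u \<bullet> p) *\<^sub>R rot u"
proof -
  have u: "u $ 1 * u $ 1 + u $ 2 * u $ 2 = 1"
    using assms by (simp add: norm_eq_1 inner_2)
  have "p $ 1 = (u $ 1 * u $ 1 + u $ 2 * u $ 2) * p $ 1" "p $ 2 = (u $ 1 * u $ 1 + u $ 2 * u $ 2) * p $ 2"
    by (simp_all add: u)
  then show ?thesis by (simp add: vec_eq_iff forall_2 inner_2 algebra_simps)
qed

text \<open>
  The unit vector \<open>x / |x|\<close> rotates with angular velocity \<open>L / |x|\<^sup>2\<close>, so integrating this velocity gives
  a differentiable angle, here measured from an arbitrary unit vector \<open>u\<close>.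
\<close>

lemma kepler_true_anomaly:
  assumes x: "kepler_solution x v" and L: "L = angular_momentum (x 0) (v 0)" and u: "norm u = 1"
  obtains \<theta> where
    "\<And>t. t \<in> {0..T} \<Longrightarrow> (\<theta> has_real_derivative L / (norm (x t))\<^sup>2) (at t within {0..T})"
    "\<And>t. t \<in> {0..T} \<Longrightarrow> x t = norm (x t) *\<^sub>R (cos (\<theta> t) *\<^sub>R u + sin (\<theta> t) *\<^sub>R rot u)"
proof -
  note x' = kepler_solutionD(1-3)[OF x]
  have nz: "0 < norm (x t)" for t using x'(1) by simp
  define c where "c t = (u \<bullet> x t) * (1 / norm (x t) ^ 1)" for t
  define s where "s t = (rot u \<bullet> x t) * (1 / norm (x t) ^ 1)" for t
  have expand: "x t = norm (x t) *\<^sub>R (c t *\<^sub>R u + s t *\<^sub>R rot u)" for t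
    using orthogonal_expansion[OF u, of "x t"] nz[of t] by (simp add: c_def s_def scaleR_add_right)
  have cs: "(c t)\<^sup>2 + (s t)\<^sup>2 = 1" for t
  proof -
    have "x t \<bullet> x t = (norm (x t))\<^sup>2 * ((c t)\<^sup>2 + (s t)\<^sup>2)"
      by (subst (1 2) expand)
        (use u in \<open>simp add: inner_add_left inner_add_right rot_simps norm_eq_1 power2_eq_square algebra_simps\<close>)
    then show ?thesis using nz[of t] by (simp add: power2_norm_eq_inner)
  qed
  have const: "((\<lambda>t. w) has_vector_derivative 0) (at t within {0..T})" for w :: "real^2" and t
    by (rule has_vector_derivative_const)
  have proj: "((\<lambda>t. (w \<bullet> x t) * (1 / norm (x t) ^ 1)) has_real_derivative
      (w \<bullet> rot (x t)) * (1 / norm (x t)) * (L / (norm (x t))\<^sup>2)) (at t within {0..T})" for w t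
  proof -
    have "(w \<bullet> v t) * (x t \<bullet> x t) - (x t \<bullet> v t) * (w \<bullet> x t) = (w \<bullet> rot (x t)) * L"
      unfolding L kepler_constants(2)[OF x, of t, symmetric]
      by (simp add: inner_2 angular_momentum_def algebra_simps)
    then have "(w \<bullet> v t) * (norm (x t))\<^sup>2 - (x t \<bullet> v t) * (w \<bullet> x t) = (w \<bullet> rot (x t)) * L"
      by (simp add: power2_norm_eq_inner)
    then have eq: "(w \<bullet> v t) * (1 / norm (x t) ^ 1) + (- real 1 * (x t \<bullet> v t) / norm (x t) ^ (1 + 2)) * (w \<bullet> x t)
      = (w \<bullet> rot (x t)) * (1 / norm (x t)) * (L / (norm (x t))\<^sup>2)"
      using nz[of t] by (simp add: power2_eq_square power3_eq_cube field_simps)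
    have "((\<lambda>t. w \<bullet> x t) has_real_derivative w \<bullet> v t) (at t within {0..T})"
      using has_real_derivative_inner[OF const x'(2)] by simp
    from DERIV_mult[OF this has_real_derivative_inverse_norm_power[OF x'(2) x'(1), of 1]] show ?thesis
      unfolding eq[symmetric] by (simp add: algebra_simps)
  qed
  have dc: "(c has_real_derivative - s t * (L / (norm (x t))\<^sup>2)) (at t within {0..T})" for t
    using proj[of u t] unfolding c_def[abs_def] s_def by (simp add: rot_simps algebra_simps)
  have ds: "(s has_real_derivative c t * (L / (norm (x t))\<^sup>2)) (at t within {0..T})" for t
    using proj[of "rot u" t] unfolding s_def[abs_def] c_def by (simp add: rot_simps algebra_simps)
  obtain \<theta>\<^sub>0 where \<theta>\<^sub>0: "c 0 = cos \<theta>\<^sub>0" "s 0 = sin \<theta>\<^sub>0"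
    using cs[of 0] by (metis sincos_total_2pi)
  define \<theta> where "\<theta> t = \<theta>\<^sub>0 + integral {0..t} (\<lambda>s. L / (norm (x s))\<^sup>2)" for t
  have "continuous_on {0..T} x" by (rule continuous_on_vector_derivative[OF x'(2)])
  then have "continuous_on {0..T} (\<lambda>s. L / (norm (x s))\<^sup>2)"
    using x'(1) by (intro continuous_intros) auto
  note d\<theta> = integral_has_real_derivative[OF this]
  have \<theta>': "(\<theta> has_real_derivative L / (norm (x t))\<^sup>2) (at t within {0..T})" if "t \<in> {0..T}" for t
    unfolding \<theta>_def[abs_def] using d\<theta>[OF that] by (auto intro!: derivative_eq_intros)
  have "x t = norm (x t) *\<^sub>R (cos (\<theta> t) *\<^sub>R u + sin (\<theta> t) *\<^sub>R rot u)" if t: "t \<in> {0..T}" for t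
  proof -
    \<comment> \<open>The inner product of the two unit vectors is constant and equal to 1 initially, so they agree.\<close>
    define D where "D t = c t * cos (\<theta> t) + s t * sin (\<theta> t)" for t
    have "(D has_real_derivative 0) (at r within {0..T})" if "r \<in> {0..T}" for r
      unfolding D_def[abs_def]
      by (rule dc ds \<theta>'[OF that] derivative_eq_intros refl)+ (simp add: algebra_simps)
    then have "(D has_vector_derivative 0) (at r within {0..T})" if "r \<in> {0..T}" for r
      using that by (simp add: has_real_derivative_iff_has_vector_derivative)
    then obtain k where k: "\<And>r. r \<in> {0..T} \<Longrightarrow> D r = k"
      using has_vector_derivative_zero_constant[of "{0..T}" D] by (auto intro: convex_real_interval)
    have "D t = D 0" using k t by simp
    also have "D 0 = 1" by (simp add: D_def \<theta>_def \<theta>\<^sub>0 flip: power2_eq_square)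
    finally have D: "c t * cos (\<theta> t) + s t * sin (\<theta> t) = 1" by (simp add: D_def)
    have "(c t - cos (\<theta> t))\<^sup>2 + (s t - sin (\<theta> t))\<^sup>2
        = ((c t)\<^sup>2 + (s t)\<^sup>2) + ((cos (\<theta> t))\<^sup>2 + (sin (\<theta> t))\<^sup>2) - 2 * (c t * cos (\<theta> t) + s t * sin (\<theta> t))"
      by (simp add: power2_eq_square algebra_simps)
    also have "\<dots> = 0" by (simp add: cs D)
    finally have "c t = cos (\<theta> t)" "s t = sin (\<theta> t)"
      by (simp_all add: sum_power2_eq_zero_iff)
    then show ?thesis using expand[of t] by simp
  qed
  then show thesis using that \<theta>' by blast
qed

text \<open>
  With \<open>u\<close> the direction of the Laplace-Runge-Lenz vector, the angle alone fixes the point of phase space.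
  Both formulas are what the later computation of the drift needs.
\<close>

lemma kepler_orbit_angle_determines_state:
  assumes x: "kepler_solution x v" and L: "L = angular_momentum (x 0) (v 0)" "L \<noteq> 0"
    and u: "norm u = 1" and A: "lrl_vector (x 0) (v 0) = e *\<^sub>R u"
    and polar: "x t = norm (x t) *\<^sub>R (c *\<^sub>R u + s *\<^sub>R rot u)"
  shows "norm (x t) * (1 + e * c) = L\<^sup>2" "L *\<^sub>R v t = (e + c) *\<^sub>R rot u - s *\<^sub>R u"
proof -
  note conserved = kepler_constants[OF x, of t]
  have uu: "u \<bullet> u = 1" using u by (simp add: norm_eq_1)
  have nz: "norm (x t) \<noteq> 0" using kepler_solutionD(1)[OF x] by simp
  have "u \<bullet> x t = norm (x t) * c"
    by (subst polar) (simp add: inner_add_right rot_simps uu)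
  then show "norm (x t) * (1 + e * c) = L\<^sup>2"
    using orbit_equation[OF kepler_solutionD(1)[OF x], of t "v t"] by (simp add: conserved A L algebra_simps)
  have "(1 / norm (x t)) *\<^sub>R x t = c *\<^sub>R u + s *\<^sub>R rot u"
    using nz by (subst polar) simp
  then have "L *\<^sub>R v t = rot (e *\<^sub>R u + (c *\<^sub>R u + s *\<^sub>R rot u))"
    using rot_lrl_vector[of "x t" "v t"] by (simp add: conserved A L)
  then show "L *\<^sub>R v t = (e + c) *\<^sub>R rot u - s *\<^sub>R u"
    by (simp add: rot_simps algebra_simps)
qed

text \<open>
  After a period the angle has changed by \<open>2 \<pi> k\<close> with an integer \<open>k\<close> of the sign of \<open>L\<close>. If
  \<open>|k| \<ge> 2\<close>, the angle passes at an earlier time \<open>S\<close> through a value congruent to the initial one; there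
  position and velocity are the initial ones, so by uniqueness \<open>S\<close> is a period as well.
\<close>

lemma true_anomaly_over_period:
  assumes x: "kepler_solution x v" and L: "L = angular_momentum (x 0) (v 0)" "L \<noteq> 0"
    and u: "norm u = 1" and A: "lrl_vector (x 0) (v 0) = e *\<^sub>R u"
    and T: "is_minimal_period x T"
    and d\<theta>: "\<And>t. t \<in> {0..T} \<Longrightarrow> (\<theta> has_real_derivative L / (norm (x t))\<^sup>2) (at t within {0..T})"
    and polar: "\<And>t. t \<in> {0..T} \<Longrightarrow> x t = norm (x t) *\<^sub>R (cos (\<theta> t) *\<^sub>R u + sin (\<theta> t) *\<^sub>R rot u)"
  shows "\<theta> T = \<theta> 0 + 2 * pi * sgn L"
proof -
  have T0: "0 < T" and per: "\<And>t. x (t + T) = x t"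
    and minimal: "\<And>S. 0 < S \<Longrightarrow> S < T \<Longrightarrow> \<exists>t. x (t + S) \<noteq> x t"
    using T by (auto simp: is_minimal_period_def)
  note nz = kepler_solutionD(1)[OF x]
  have ends: "0 \<in> {0..T}" "T \<in> {0..T}" using T0 by auto
  note state = kepler_orbit_angle_determines_state[OF x L u A polar]
  have uu: "u \<bullet> u = 1" using u by (simp add: norm_eq_1)
  \<comment> \<open>The sign makes the angle increasing.\<close>
  define \<phi> where "\<phi> t = sgn L * \<theta> t" for t
  have \<theta>: "\<theta> t = sgn L * \<phi> t" for t using L(2) by (simp add: \<phi>_def sgn_if)
  have cont: "continuous_on {0..T} \<phi>"
    unfolding \<phi>_def using d\<theta> by (intro continuous_intros DERIV_continuous_on)
  have mono: "\<phi> r < \<phi> s" if "0 \<le> r" "r < s" "s \<le> T" for r s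
  proof (rule DERIV_pos_imp_increasing_open[OF that(2)])
    show "continuous_on {r..s} \<phi>" using cont that by (auto intro: continuous_on_subset)
    fix t assume t: "r < t" "t < s"
    then have "(\<theta> has_real_derivative L / (norm (x t))\<^sup>2) (at t)"
      using d\<theta>[of t] that at_within_Icc_at[of 0 t T] by auto
    then have "(\<phi> has_real_derivative sgn L * (L / (norm (x t))\<^sup>2)) (at t)"
      unfolding \<phi>_def[abs_def] by (rule DERIV_cmult)
    moreover have "sgn L * (L / (norm (x t))\<^sup>2) > 0"
      using L(2) nz[of t] by (simp add: sgn_if)
    ultimately show "\<exists>y. (\<phi> has_real_derivative y) (at t) \<and> 0 < y" by blast
  qed
  have "cos (\<theta> T) = cos (\<theta> 0)" "sin (\<theta> T) = sin (\<theta> 0)"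
  proof -
    have "x T = x 0" using per[of 0] by simp
    then have eq: "cos (\<theta> T) *\<^sub>R u + sin (\<theta> T) *\<^sub>R rot u = cos (\<theta> 0) *\<^sub>R u + sin (\<theta> 0) *\<^sub>R rot u"
      using polar[OF ends(1)] polar[OF ends(2)] nz[of 0]
      by (metis norm_eq_zero scaleR_cancel_left)
    show "cos (\<theta> T) = cos (\<theta> 0)"
      using arg_cong[OF eq, of "\<lambda>w. u \<bullet> w"] by (simp add: inner_add_right rot_simps uu)
    show "sin (\<theta> T) = sin (\<theta> 0)"
      using arg_cong[OF eq, of "\<lambda>w. rot u \<bullet> w"] by (simp add: inner_add_right rot_simps uu)
  qed
  then obtain n :: int where n: "\<theta> T = \<theta> 0 + 2 * pi * n"
    using sin_cos_eq_iff by metis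
  define k where "k = (if L > 0 then n else - n)"
  have \<phi>T: "\<phi> T = \<phi> 0 + 2 * pi * k"
    using n L(2) by (auto simp: \<phi>_def k_def sgn_if algebra_simps)
  have "\<phi> 0 < \<phi> T" using mono T0 by auto
  then have "k > 0" using \<phi>T by (simp add: zero_less_mult_iff)
  moreover have "\<not> k \<ge> 2"
  proof
    assume "k \<ge> 2"
    then have "\<phi> 0 + 2 * pi < \<phi> T" using \<phi>T pi_gt_zero by (auto simp: algebra_simps)
    then obtain S where S: "0 \<le> S" "S \<le> T" "\<phi> S = \<phi> 0 + 2 * pi"
      using IVT'[of \<phi> 0 "\<phi> 0 + 2 * pi" T] cont T0 by auto
    have S': "0 < S" "S < T" "S \<in> {0..T}"
      using S \<open>\<phi> 0 + 2 * pi < \<phi> T\<close> pi_gt_zero by (auto simp: order.strict_iff_order)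
    have cs: "cos (\<theta> S) = cos (\<theta> 0)" "sin (\<theta> S) = sin (\<theta> 0)"
    proof -
      have "\<theta> S = sgn L * (\<phi> 0 + 2 * pi)" "\<theta> 0 = sgn L * \<phi> 0" using \<theta> S(3) by simp_all
      moreover have "sgn L = 1 \<or> sgn L = - 1" using L(2) by (simp add: sgn_if)
      ultimately show "cos (\<theta> S) = cos (\<theta> 0)" "sin (\<theta> S) = sin (\<theta> 0)"
        by (auto simp only: mult_1_left mult_minus1 cos_minus sin_minus cos_periodic sin_periodic)
    qed
    have "norm (x S) * (1 + e * cos (\<theta> 0)) = norm (x 0) * (1 + e * cos (\<theta> 0))"
      using state(1)[OF S'(3)] state(1)[OF ends(1)] by (simp add: cs)
    moreover have "1 + e * cos (\<theta> 0) \<noteq> 0" using state(1)[OF ends(1)] L by auto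
    ultimately have "norm (x S) = norm (x 0)" by simp
    then have xS: "x S = x 0" using polar[OF S'(3)] polar[OF ends(1)] by (simp add: cs)
    have "L *\<^sub>R v S = L *\<^sub>R v 0" using state(2)[OF S'(3)] state(2)[OF ends(1)] by (simp only: cs)
    then have vS: "v S = v 0" using L(2) by simp
    have shift: "kepler_solution (\<lambda>t. x (t + S)) (\<lambda>t. v (t + S))"
      unfolding kepler_solution_def
    proof (intro allI conjI)
      fix t
      have sh: "((\<lambda>t. t + S) has_vector_derivative 1) (at t)" by (auto intro!: derivative_eq_intros)
      show "x (t + S) \<noteq> 0" by (rule nz)
      show "((\<lambda>t. x (t + S)) has_vector_derivative v (t + S)) (at t)"
        using vector_diff_chain_at[OF sh kepler_solutionD(2)[OF x]] by (simp add: o_def)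
      show "((\<lambda>t. v (t + S)) has_vector_derivative kepler_force (x (t + S))) (at t)"
        using vector_diff_chain_at[OF sh kepler_solutionD(3)[OF x]] by (simp add: o_def)
    qed
    \<comment> \<open>Uniqueness is used forward in time; the period \<open>T\<close> carries the conclusion to negative times.\<close>
    have fwd: "x (t + S) = x t" if "0 \<le> t" for t
      using kepler_solution_unique[OF x shift _ _ that] xS vS by simp
    have pern: "x (t + real m * T) = x t" for t m
    proof (induction m)
      case (Suc m)
      have "x (t + real (Suc m) * T) = x ((t + real m * T) + T)" by (simp add: algebra_simps)
      then show ?case using per Suc by simp
    qed simp
    have "x (t + S) = x t" for t
    proof -
      obtain m :: nat where "- t < real m * T" using reals_Archimedean3[OF T0] by blast
      then have "x ((t + real m * T) + S) = x (t + real m * T)" by (intro fwd) simp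
      moreover have "(t + real m * T) + S = (t + S) + real m * T" by simp
      ultimately show ?thesis using pern by metis
    qed
    then show False using minimal[OF S'(1,2)] by blast
  qed
  ultimately have "k = 1" by simp
  then show ?thesis using \<phi>T L(2) by (simp add: \<theta> algebra_simps sgn_if)
qed

section \<open>The leading term of the drift in the true anomaly\<close>

text \<open>
  Up to a power of \<open>L\<close>, the drift of the Laplace-Runge-Lenz vector transversal to itself, per unit of
  \<open>h\<^sup>2\<close>, as a function of the true anomaly. The linear term carries the mean value of the trigonometric
  polynomial \<open>precession_integrand\<close>. The other coefficients solve the triangular system that results
  from \<open>(sin \<theta> cos\<^sup>m \<theta>)' = (m + 1) cos\<^sup>m\<^sup>+\<^sup>1 \<theta> - m cos\<^sup>m\<^sup>-\<^sup>1 \<theta>\<close>.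
\<close>

definition precession_primitive :: "real \<Rightarrow> real \<Rightarrow> real" where
  "precession_primitive e \<theta> = - (e\<^sup>2 * (4 + e\<^sup>2) / 16) * \<theta> + sin \<theta> * ((e / 12 - e ^ 3 / 3)
     + (3 * e\<^sup>2 / 4 - e ^ 4 / 16) * cos \<theta> + 4 * e ^ 3 / 3 * cos \<theta> ^ 2 + 23 * e ^ 4 / 24 * cos \<theta> ^ 3
     + e ^ 5 / 4 * cos \<theta> ^ 4)"

text \<open>
  Here \<open>c\<close> is the cosine of the true anomaly and \<open>q\<close> stands for \<open>L\<^sup>2 |v|\<^sup>2 = 1 + 2 e c + e\<^sup>2\<close>; the formula
  arises from substituting \<open>|x| = L\<^sup>2 / (1 + e c)\<close> in the rate of change of the vector.
\<close>

definition precession_integrand :: "real \<Rightarrow> real \<Rightarrow> real \<Rightarrow> real" where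
  "precession_integrand e c q = e\<^sup>2 * (1 - c\<^sup>2) * ((1 + e * c)\<^sup>2 / 6 + 5 / 4 * (e\<^sup>2 * (1 - c\<^sup>2)) * (1 + e * c) - 5 / 4 * q * (1 + e * c))
     - (e\<^sup>2 + e * c) * ((1 + e * c)\<^sup>2 / 6 + e\<^sup>2 * (1 - c\<^sup>2) * (1 + e * c) / 4 - q * (1 + e * c) / 4)"

lemma precession_primitive_derivative:
  "(precession_primitive e has_real_derivative precession_integrand e (cos \<theta>) (1 + 2 * e * cos \<theta> + e\<^sup>2)) (at \<theta>)"
proof -
  have s2: "sin \<theta> * sin \<theta> = 1 - cos \<theta> * cos \<theta>"
    using sin_cos_squared_add[of \<theta>] by (simp add: power2_eq_square)
  have s2': "sin \<theta> * (sin \<theta> * z) = (1 - cos \<theta> * cos \<theta>) * z" for z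
    by (simp add: s2 flip: mult.assoc)
  show ?thesis
    unfolding precession_primitive_def[abs_def]
    by (rule derivative_eq_intros refl)+
      (simp add: precession_integrand_def power2_eq_square power3_eq_cube power4_eq_xxxx
        eval_nat_numeral field_simps s2 s2')
qed

text \<open>
  The correction decomposed along position and velocity, the form in which its inner products with the
  orbit data can be read off.
\<close>

lemma kepler_verlet_term_coefficients:
  assumes "x \<noteq> 0"
  shows "kepler_verlet_term x v =
    (1 / 6 / norm x ^ 6 + 5 / 4 * (x \<bullet> v)\<^sup>2 / norm x ^ 7 - (v \<bullet> v) / 4 / norm x ^ 5) *\<^sub>R x
      - ((x \<bullet> v) / 2 / norm x ^ 5) *\<^sub>R v"
proof -
  have "3 * (x \<bullet> kepler_force x) * (1 / norm x ^ 5) = - 3 * (1 / norm x ^ 6)"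
    using assms by (simp add: kepler_force_def power2_norm_eq_inner[symmetric] field_simps flip: power_add)
  moreover have "(1 / norm x ^ 3) *\<^sub>R kepler_force x = - (1 / norm x ^ 6) *\<^sub>R x"
    by (simp add: kepler_force_def flip: power_add)
  ultimately have "kepler_force_deriv x (kepler_force x) = (- 2 * (1 / norm x ^ 6)) *\<^sub>R x"
    unfolding kepler_force_deriv_def by (simp add: scaleR_diff_left[symmetric] del: scaleR_minus_left)
  then show ?thesis
    unfolding kepler_verlet_term_def kepler_force_deriv2_def
    by (simp add: vec_eq_iff algebra_simps)
qed

text \<open>
  The chain rule factor \<open>L / |x|\<^sup>2 = \<theta>'\<close> is split off, so that the right-hand side is the time
  derivative of \<open>precession_primitive e \<theta> / L ^ 6\<close>.
\<close>

lemma precession_integrand_eq: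
  assumes u: "norm u = 1" and L: "L \<noteq> 0" and cs: "c\<^sup>2 + s\<^sup>2 = 1" and nz: "x \<noteq> 0"
    and r: "norm x * (1 + e * c) = L\<^sup>2"
    and x: "x = norm x *\<^sub>R (c *\<^sub>R u + s *\<^sub>R rot u)"
    and v: "L *\<^sub>R v = (e + c) *\<^sub>R rot u - s *\<^sub>R u"
  shows "rot (e *\<^sub>R u) \<bullet> lrl_rate x v (kepler_verlet_term x v)
    = precession_integrand e c (1 + 2 * e * c + e\<^sup>2) / L ^ 6 * (L / (norm x)\<^sup>2)"
proof -
  have uu: "u \<bullet> u = 1" using u by (simp add: norm_eq_1)
  define U where "U = 1 + e * c"
  define q where "q = 1 + 2 * e * c + e\<^sup>2"
  define \<rho> where "\<rho> = norm x"
  have s2: "s\<^sup>2 = 1 - c\<^sup>2" using cs by simp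
  have \<rho>U: "\<rho> * U = L\<^sup>2" using r by (simp add: U_def \<rho>_def)
  then have "U \<noteq> 0" using L by auto
  with \<rho>U have U: "U \<noteq> 0" "\<rho> = L\<^sup>2 / U" by (auto simp: field_simps)
  have v': "v = (1 / L) *\<^sub>R ((e + c) *\<^sub>R rot u - s *\<^sub>R u)" using L by (simp flip: v)
  have Ax: "rot u \<bullet> x = \<rho> * s"
    by (subst x) (simp add: inner_add_right rot_simps uu \<rho>_def)
  have Av: "rot u \<bullet> v = (e + c) / L"
    by (simp add: v' inner_diff_right rot_simps uu)
  have xv: "x \<bullet> v = e * s * \<rho> / L"
    by (subst x, subst v') (simp add: inner_diff_right inner_add_left rot_simps uu \<rho>_def algebra_simps)
  have vv: "v \<bullet> v = q / L\<^sup>2"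
  proof -
    have "(L *\<^sub>R v) \<bullet> (L *\<^sub>R v) = (e + c)\<^sup>2 + s\<^sup>2"
      unfolding v by (simp add: inner_diff_right inner_diff_left rot_simps(4-6) uu power2_eq_square)
    also have "\<dots> = q" using cs by (simp add: q_def power2_eq_square algebra_simps)
    finally show ?thesis using L by (simp add: power2_eq_square field_simps)
  qed
  have xx: "x \<bullet> x = \<rho>\<^sup>2" by (simp add: \<rho>_def power2_norm_eq_inner)
  define \<alpha> where "\<alpha> = 1 / 6 / \<rho> ^ 6 + 5 / 4 * (x \<bullet> v)\<^sup>2 / \<rho> ^ 7 - (v \<bullet> v) / 4 / \<rho> ^ 5"
  define \<beta> where "\<beta> = - ((x \<bullet> v) / 2 / \<rho> ^ 5)"
  have \<eta>: "kepler_verlet_term x v = \<alpha> *\<^sub>R x + \<beta> *\<^sub>R v"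
    using kepler_verlet_term_coefficients[OF nz] by (simp add: \<alpha>_def \<beta>_def \<rho>_def)
  have v\<eta>: "v \<bullet> (\<alpha> *\<^sub>R x + \<beta> *\<^sub>R v) = \<alpha> * (x \<bullet> v) + \<beta> * (v \<bullet> v)"
    and x\<eta>: "x \<bullet> (\<alpha> *\<^sub>R x + \<beta> *\<^sub>R v) = \<alpha> * \<rho>\<^sup>2 + \<beta> * (x \<bullet> v)"
    and rot\<eta>: "rot u \<bullet> (\<alpha> *\<^sub>R x + \<beta> *\<^sub>R v) = \<alpha> * (\<rho> * s) + \<beta> * ((e + c) / L)"
    by (simp_all add: inner_add_right xx Ax Av inner_commute[of v x])
  have "rot (e *\<^sub>R u) \<bullet> lrl_rate x v (kepler_verlet_term x v)
    = e * ((\<alpha> * (x \<bullet> v) + 2 * \<beta> * (v \<bullet> v)) * (\<rho> * s) - (\<alpha> * \<rho>\<^sup>2 + 2 * \<beta> * (x \<bullet> v)) * ((e + c) / L))"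
    unfolding \<eta> lrl_rate_def rot_simps(2) inner_scaleR_left inner_diff_right inner_scaleR_right v\<eta> x\<eta> rot\<eta> Ax Av
    by (simp add: algebra_simps)
  also have "(\<alpha> * (x \<bullet> v) + 2 * \<beta> * (v \<bullet> v)) * (\<rho> * s)
    = e * s\<^sup>2 * U ^ 2 * (U\<^sup>2 / 6 + 5 / 4 * (e\<^sup>2 * s\<^sup>2) * U - 5 / 4 * q * U) / L ^ 9"
    using U(1) L unfolding \<alpha>_def \<beta>_def xv vv U(2) by (simp add: field_simps power2_eq_square eval_nat_numeral)
  also have "(\<alpha> * \<rho>\<^sup>2 + 2 * \<beta> * (x \<bullet> v)) = U ^ 2 * (U\<^sup>2 / 6 + e\<^sup>2 * s\<^sup>2 * U / 4 - q * U / 4) / L ^ 8"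
    using U(1) L unfolding \<alpha>_def \<beta>_def xv vv U(2) by (simp add: field_simps power2_eq_square eval_nat_numeral)
  also have "e * (e * s\<^sup>2 * U ^ 2 * (U\<^sup>2 / 6 + 5 / 4 * (e\<^sup>2 * s\<^sup>2) * U - 5 / 4 * q * U) / L ^ 9
      - U ^ 2 * (U\<^sup>2 / 6 + e\<^sup>2 * s\<^sup>2 * U / 4 - q * U / 4) / L ^ 8 * ((e + c) / L))
    = U\<^sup>2 * precession_integrand e c q / L ^ 9"
  proof -
    have "e * (e * s\<^sup>2 * U ^ 2 * X / L ^ 9 - U ^ 2 * Y / L ^ 8 * ((e + c) / L))
      = U\<^sup>2 * (e\<^sup>2 * s\<^sup>2 * X - (e\<^sup>2 + e * c) * Y) / L ^ 9" for X Y
      using L by (simp add: field_simps power2_eq_square eval_nat_numeral)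
    then show ?thesis by (simp add: precession_integrand_def s2 U_def[symmetric])
  qed
  also have "\<dots> = precession_integrand e c q / L ^ 6 * (L / \<rho>\<^sup>2)"
  proof -
    have "U\<^sup>2 * Z / L ^ 9 = Z / L ^ 6 * (L / (L\<^sup>2 / U)\<^sup>2)" for Z
      using U(1) L by (simp add: field_simps power2_eq_square eval_nat_numeral)
    then show ?thesis unfolding U(2) .
  qed
  finally show ?thesis by (simp add: q_def \<rho>_def)
qed

section \<open>Drift of the Laplace-Runge-Lenz vector under the modified equation\<close>

lemma norm_lrl_rate_le: "norm (lrl_rate y v \<eta>) \<le> 4 * norm y * norm v * norm \<eta>"
proof -
  have "norm (lrl_rate y v \<eta>) \<le> norm ((2 * (v \<bullet> \<eta>)) *\<^sub>R y) + norm ((y \<bullet> \<eta>) *\<^sub>R v) + norm ((y \<bullet> v) *\<^sub>R \<eta>)"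
    unfolding lrl_rate_def by (intro order_trans[OF norm_triangle_ineq4] add_mono order_refl)
  also have "\<dots> = 2 * \<bar>v \<bullet> \<eta>\<bar> * norm y + \<bar>y \<bullet> \<eta>\<bar> * norm v + \<bar>y \<bullet> v\<bar> * norm \<eta>"
    by (simp add: abs_mult)
  also have "\<dots> \<le> 2 * (norm v * norm \<eta>) * norm y + (norm y * norm \<eta>) * norm v + (norm y * norm v) * norm \<eta>"
    by (intro add_mono mult_right_mono mult_left_mono Cauchy_Schwarz_ineq2) auto
  finally show ?thesis by (simp add: algebra_simps)
qed

lemma lrl_rate_linear:
  "lrl_rate y v (\<eta> + \<zeta>) = lrl_rate y v \<eta> + lrl_rate y v \<zeta>" "lrl_rate y v (k *\<^sub>R \<eta>) = k *\<^sub>R lrl_rate y v \<eta>"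
  by (simp_all add: lrl_rate_def inner_add_right algebra_simps)

lemma bounded_lipschitz_on_lrl_rate:
  assumes S: "bounded S" and g: "bounded_lipschitz_on S (\<lambda>z. g (fst z) (snd z))"
  shows "bounded_lipschitz_on S (\<lambda>z. w \<bullet> lrl_rate (fst z) (snd z) (g (fst z) (snd z)))"
proof -
  have eq: "lrl_rate y v \<eta> = (2 *\<^sub>R (v \<bullet> \<eta>)) *\<^sub>R y - (y \<bullet> \<eta>) *\<^sub>R v - (y \<bullet> v) *\<^sub>R \<eta>" for y v \<eta>
    by (simp add: lrl_rate_def)
  show ?thesis unfolding eq
    by (intro bounded_lipschitz_on_inner bounded_lipschitz_on_diff bounded_lipschitz_on_scaleR
        bounded_lipschitz_on_const bounded_lipschitz_on_fst[OF S] bounded_lipschitz_on_snd[OF S] g)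
qed

lemma solves_second_orderE:
  assumes "solves_second_order F S \<epsilon> I y v"
  obtains a where "\<And>t. t \<in> I \<Longrightarrow> y t \<in> S"
    "\<And>t. t \<in> I \<Longrightarrow> (y has_vector_derivative v t) (at t within I)"
    "\<And>t. t \<in> I \<Longrightarrow> (v has_vector_derivative a t) (at t within I)"
    "\<And>t. t \<in> I \<Longrightarrow> norm (a t - F (y t) (v t)) \<le> \<epsilon>"
proof -
  have "\<forall>t\<in>I. \<exists>w. (v has_vector_derivative w) (at t within I) \<and> norm (w - F (y t) (v t)) \<le> \<epsilon>"
    using assms by (auto simp: solves_second_order_def)
  from bchoice[OF this] obtain a where "\<forall>t\<in>I. (v has_vector_derivative a t) (at t within I) \<and>
      norm (a t - F (y t) (v t)) \<le> \<epsilon>" ..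
  then show thesis using assms that[of a] by (simp add: solves_second_order_def)
qed

text \<open>
  The function \<open>W\<close> is a primitive of the rate of change, per unit of \<open>h\<^sup>2\<close>, of the component along \<open>w\<close>,
  evaluated on the unperturbed orbit. Since the perturbed orbit is \<open>O(h\<^sup>2)\<close>-close and the rate is
  Lipschitz, the function \<open>w \<bullet> A - h\<^sup>2 W\<close> has a derivative of order \<open>h\<^sup>4\<close> along the perturbed orbit. The
  constant \<open>C\<close> is uniform over all admissible perturbed solutions.
\<close>

lemma lrl_vector_drift:
  assumes x: "kepler_solution x v" and T: "0 \<le> T"
    and g: "C1_differentiable ((- {0}) \<times> UNIV) (\<lambda>(x, v). g x v)"
    and W: "\<And>t. t \<in> {0..T} \<Longrightarrow>
      (W has_real_derivative w \<bullet> lrl_rate (x t) (v t) (g (x t) (v t))) (at t within {0..T})"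
  obtains C where "0 \<le> C" "\<forall>\<^sub>F h in at_right 0. \<forall>y u. y 0 = x 0 \<longrightarrow> u 0 = v 0 \<longrightarrow>
      solves_second_order (truncated_modified_force kepler_force g h) (- {0}) (K * h ^ 4) {0..T} y u \<longrightarrow>
      (\<forall>t\<in>{0..T}. norm (lrl_vector (y t) (u t) - lrl_vector (x 0) (v 0)) \<le> C * h\<^sup>2) \<and>
      \<bar>w \<bullet> (lrl_vector (y T) (u T) - lrl_vector (x 0) (v 0)) - h\<^sup>2 * (W T - W 0)\<bar> \<le> C * h ^ 4"
proof -
  obtain N \<delta> where N: "compact N" "N \<subseteq> (- {0}) \<times> UNIV" "0 < \<delta>"
    and tube: "\<And>t. t \<in> {0..T} \<Longrightarrow> cball (x t, v t) \<delta> \<subseteq> N"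
    using tube_around_solution[OF x, of T] by blast
  let ?G = "\<lambda>z. g (fst z) (snd z)"
  let ?\<Gamma> = "\<lambda>z. w \<bullet> lrl_rate (fst z) (snd z) (?G z)"
  obtain C0 where lip: "C0-lipschitz_on N (modified_field g 0)"
    using modified_field_bounds[OF g N(1,2)] by (metis atLeastAtMost_iff order_refl zero_le_one)
  have G: "bounded_lipschitz_on N ?G" by (rule bounded_lipschitz_on_forces(2)[OF g N(1,2)])
  obtain B where B: "0 \<le> B" "\<And>z. z \<in> N \<Longrightarrow> norm (?G z) \<le> B"
    using bounded_lipschitz_onE[OF G] by blast
  obtain D where D: "0 \<le> D" "D-lipschitz_on N ?\<Gamma>"
    using bounded_lipschitz_onE[OF bounded_lipschitz_on_lrl_rate[OF compact_imp_bounded[OF N(1)] G]] by blast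
  obtain R where R: "0 \<le> R" "\<And>z. z \<in> N \<Longrightarrow> norm (fst z) \<le> R" "\<And>z. z \<in> N \<Longrightarrow> norm (snd z) \<le> R"
  proof -
    obtain R where R: "\<And>z. z \<in> N \<Longrightarrow> norm z \<le> R"
      using compact_imp_bounded[OF N(1)] by (auto simp: bounded_iff)
    have "norm (fst z) \<le> max R 0 \<and> norm (snd z) \<le> max R 0" if "z \<in> N" for z
      using R[OF that] norm_fst_le[where x = "fst z" and y = "snd z"]
        norm_snd_le[where x = "fst z" and y = "snd z"] unfolding prod.collapse le_max_iff_disj by linarith
    then show thesis by (intro that[of "max R 0"]) auto
  qed
  \<comment> \<open>For \<open>h \<le> 1\<close> the total perturbation \<open>h\<^sup>2 g + O(h\<^sup>4)\<close> is at most \<open>M h\<^sup>2\<close>, and \<open>X\<close> is Gronwall's factor.\<close>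
  define M where "M = B + \<bar>K\<bar>"
  define X where "X = exp ((C0 + 1) * T)"
  have M: "0 \<le> M" and X: "0 < X" using B by (auto simp: M_def X_def)
  define C1 where "C1 = 4 * R * R * M * T"
  define C2 where "C2 = (D * (M * X) + norm w * (4 * R * R * \<bar>K\<bar>)) * T"
  define h\<^sub>0 where "h\<^sub>0 = min 1 (\<delta> / (M * X + 1))"
  have MX: "0 < M * X + 1" using M X by (simp add: add_nonneg_pos)
  have C12: "0 \<le> C1" "0 \<le> C2"
    using M X R(1) T D(1) by (auto simp: C1_def C2_def)
  show thesis
  proof (rule that[of "max C1 C2"], goal_cases)
    case 1
    show ?case using C12 by simp
  next
    case 2
    show ?case unfolding eventually_at_right_field
    proof (intro exI[of _ h\<^sub>0] conjI allI impI ballI)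
      show "0 < h\<^sub>0" using N(3) MX by (simp add: h\<^sub>0_def)
      fix h y u
      assume h: "0 < h" "h < h\<^sub>0" and init: "y 0 = x 0" "u 0 = v 0"
        and sol: "solves_second_order (truncated_modified_force kepler_force g h) (- {0}) (K * h ^ 4) {0..T} y u"
      have h1: "h \<le> 1" using h by (simp add: h\<^sub>0_def)
      have h42: "h ^ 4 \<le> h\<^sup>2" using h h1 by (intro power_decreasing) auto
      obtain a where a: "\<And>t. t \<in> {0..T} \<Longrightarrow> y t \<noteq> 0"
        "\<And>t. t \<in> {0..T} \<Longrightarrow> (y has_vector_derivative u t) (at t within {0..T})"
        "\<And>t. t \<in> {0..T} \<Longrightarrow> (u has_vector_derivative a t) (at t within {0..T})"
        "\<And>t. t \<in> {0..T} \<Longrightarrow> norm (a t - (kepler_force (y t) + h\<^sup>2 *\<^sub>R g (y t) (u t))) \<le> K * h ^ 4"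
        using solves_second_orderE[OF sol] by (auto simp: truncated_modified_force_def)
      define d where "d t = a t - (kepler_force (y t) + h\<^sup>2 *\<^sub>R g (y t) (u t))" for t
      have d: "norm (d t) \<le> \<bar>K\<bar> * h ^ 4" if "t \<in> {0..T}" for t
        using a(4)[OF that] by (simp add: d_def order_trans[OF _ mult_right_mono[of K "\<bar>K\<bar>" "h ^ 4"]])
      have \<eta>: "a t - kepler_force (y t) = h\<^sup>2 *\<^sub>R g (y t) (u t) + d t" for t
        by (simp add: d_def)
      have \<eta>_le: "norm (a t - kepler_force (y t)) \<le> M * h\<^sup>2" if "t \<in> {0..T}" "(y t, u t) \<in> N" for t
      proof -
        have "norm (a t - kepler_force (y t)) \<le> h\<^sup>2 * B + \<bar>K\<bar> * h ^ 4"
          unfolding \<eta> using B(2)[OF that(2)] d[OF that(1)]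
          by (intro norm_triangle_le add_mono) (auto intro: mult_left_mono)
        also have "\<dots> \<le> h\<^sup>2 * B + \<bar>K\<bar> * h\<^sup>2" using h42 by (intro add_left_mono mult_left_mono) auto
        finally show ?thesis by (simp add: M_def algebra_simps)
      qed
      have small: "(M * h\<^sup>2) * X < \<delta>"
      proof -
        have "h\<^sup>2 \<le> h" using h h1 by (simp add: power2_eq_square mult_left_le)
        then have "(M * X) * h\<^sup>2 \<le> (M * X) * h" using M X by (intro mult_left_mono) auto
        also have "\<dots> \<le> (M * X + 1) * h" using h by simp
        also have "\<dots> < \<delta>"
          using h MX by (simp add: h\<^sub>0_def pos_less_divide_eq mult.commute)
        finally show ?thesis by (simp add: mult_ac)
      qed
      have near: "norm ((y t, u t) - (x t, v t)) \<le> (M * h\<^sup>2) * X" if t: "t \<in> {0..T}" for t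
        unfolding X_def
      proof (rule solution_stability[where Z = "\<lambda>t. (y t, u t)" and Z' = "\<lambda>t. (u t, a t)",
            OF kepler_solutionD(4)[OF x] tube lip])
        fix t assume t: "t \<in> {0..T}"
        show "((\<lambda>t. (y t, u t)) has_vector_derivative (u t, a t)) (at t within {0..T})"
          by (intro has_vector_derivative_Pair a t)
        assume "norm ((y t, u t) - (x t, v t)) \<le> \<delta>"
        then have "(y t, u t) \<in> N" using tube[OF t] by (auto simp: subset_iff dist_norm norm_minus_commute)
        then show "norm ((u t, a t) - modified_field g 0 (y t, u t)) \<le> M * h\<^sup>2"
          using \<eta>_le[OF t] by (simp add: modified_field_def truncated_modified_force_def)
      qed (use init M small t in \<open>auto simp: X_def\<close>)
      have inN: "(y t, u t) \<in> N" "(x t, v t) \<in> N" if t: "t \<in> {0..T}" for t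
        using near[OF t] small tube[OF t] N(3) by (auto simp: subset_iff dist_norm norm_minus_commute)
      define A where "A t = lrl_vector (y t) (u t)" for t
      have dA: "(A has_vector_derivative lrl_rate (y t) (u t) (a t - kepler_force (y t))) (at t within {0..T})"
        if "t \<in> {0..T}" for t
        unfolding A_def[abs_def] by (rule lrl_vector_along_curve[OF a(2,3,1)]) (rule that)+
      have rate: "norm (lrl_rate (y t) (u t) \<zeta>) \<le> 4 * R * R * norm \<zeta>" if t: "t \<in> {0..T}" for t \<zeta>
        by (rule order_trans[OF norm_lrl_rate_le])
          (use R(2,3)[OF inN(1)[OF t]] R(1) in \<open>auto intro!: mult_mono mult_nonneg_nonneg\<close>)
      have A0: "A 0 = lrl_vector (x 0) (v 0)" by (simp add: A_def init)
      have drift: "norm (A t - A 0) \<le> C1 * h\<^sup>2" if t: "t \<in> {0..T}" for t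
      proof -
        have "norm (A t - A 0) \<le> (4 * R * R * (M * h\<^sup>2)) * (t - 0)"
        proof (rule vector_derivative_bound[where f' = "\<lambda>t. lrl_rate (y t) (u t) (a t - kepler_force (y t))"])
          fix s assume "s \<in> {0..t}"
          then have s: "s \<in> {0..T}" using t by auto
          show "(A has_vector_derivative lrl_rate (y s) (u s) (a s - kepler_force (y s))) (at s within {0..t})"
            by (rule has_vector_derivative_within_subset[OF dA[OF s]]) (use t in auto)
          show "norm (lrl_rate (y s) (u s) (a s - kepler_force (y s))) \<le> 4 * R * R * (M * h\<^sup>2)"
            by (rule order_trans[OF rate[OF s]]) (use R(1) \<eta>_le[OF s inN(1)[OF s]] in \<open>auto intro!: mult_left_mono\<close>)
        qed (use t in auto)
        also have "\<dots> \<le> (4 * R * R * (M * h\<^sup>2)) * T" using t R(1) M by (intro mult_left_mono) auto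
        finally show ?thesis by (simp add: C1_def mult_ac)
      qed
      define S where "S t = w \<bullet> A t - h\<^sup>2 * W t" for t
      let ?S' = "\<lambda>t. h\<^sup>2 * (?\<Gamma> (y t, u t) - ?\<Gamma> (x t, v t)) + w \<bullet> lrl_rate (y t) (u t) (d t)"
      have "norm (S T - S 0) \<le> ((D * (M * X) + norm w * (4 * R * R * \<bar>K\<bar>)) * h ^ 4) * (T - 0)"
      proof (rule vector_derivative_bound[OF T, where f' = ?S'])
        fix t assume t: "t \<in> {0..T}"
        have "((\<lambda>t. w \<bullet> A t) has_real_derivative w \<bullet> lrl_rate (y t) (u t) (a t - kepler_force (y t))) (at t within {0..T})"
          using has_real_derivative_inner[OF has_vector_derivative_const dA[OF t]] by simp
        then have "(S has_real_derivative ?S' t) (at t within {0..T})"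
          unfolding S_def[abs_def]
          by (rule DERIV_cong[OF DERIV_diff[OF _ DERIV_cmult[OF W[OF t]]]])
            (simp add: \<eta> lrl_rate_linear inner_add_right algebra_simps)
        then show "(S has_vector_derivative ?S' t) (at t within {0..T})"
          by (simp add: has_real_derivative_iff_has_vector_derivative)
        have "\<bar>?\<Gamma> (y t, u t) - ?\<Gamma> (x t, v t)\<bar> \<le> D * norm ((y t, u t) - (x t, v t))"
          using lipschitz_onD[OF D(2) inN[OF t]] by (simp add: dist_norm)
        also have "\<dots> \<le> D * ((M * h\<^sup>2) * X)" by (intro mult_left_mono near t D)
        finally have 1: "h\<^sup>2 * \<bar>?\<Gamma> (y t, u t) - ?\<Gamma> (x t, v t)\<bar> \<le> h\<^sup>2 * (D * ((M * h\<^sup>2) * X))"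
          by (rule mult_left_mono) simp
        have "\<bar>w \<bullet> lrl_rate (y t) (u t) (d t)\<bar> \<le> norm w * norm (lrl_rate (y t) (u t) (d t))"
          by (rule Cauchy_Schwarz_ineq2)
        also have "\<dots> \<le> norm w * (4 * R * R * (\<bar>K\<bar> * h ^ 4))"
          by (intro mult_left_mono order_trans[OF rate[OF t]] d[OF t] norm_ge_zero) (use R(1) in auto)
        finally have 2: "\<bar>w \<bullet> lrl_rate (y t) (u t) (d t)\<bar> \<le> norm w * (4 * R * R * (\<bar>K\<bar> * h ^ 4))" .
        have "norm (?S' t) \<le> h\<^sup>2 * (D * ((M * h\<^sup>2) * X)) + norm w * (4 * R * R * (\<bar>K\<bar> * h ^ 4))"
          by (rule norm_triangle_le[OF add_mono]) (use 1 2 in \<open>simp_all add: abs_mult\<close>)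
        also have "\<dots> = (D * (M * X) + norm w * (4 * R * R * \<bar>K\<bar>)) * h ^ 4"
          by (simp add: algebra_simps flip: power_add)
        finally show "norm (?S' t) \<le> (D * (M * X) + norm w * (4 * R * R * \<bar>K\<bar>)) * h ^ 4" .
      qed
      then have "\<bar>w \<bullet> (A T - A 0) - h\<^sup>2 * (W T - W 0)\<bar> \<le> C2 * h ^ 4"
        by (simp add: S_def C2_def inner_diff_right algebra_simps)
      then have "\<bar>w \<bullet> (A T - A 0) - h\<^sup>2 * (W T - W 0)\<bar> \<le> max C1 C2 * h ^ 4"
        using mult_right_mono[of C2 "max C1 C2" "h ^ 4"] by simp
      moreover have "norm (A t - A 0) \<le> max C1 C2 * h\<^sup>2" if "t \<in> {0..T}" for t
        using drift[OF that] mult_right_mono[of C1 "max C1 C2" "h\<^sup>2"] by simp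
      ultimately show "\<bar>w \<bullet> (lrl_vector (y T) (u T) - lrl_vector (x 0) (v 0)) - h\<^sup>2 * (W T - W 0)\<bar> \<le> max C1 C2 * h ^ 4"
        and "t \<in> {0..T} \<Longrightarrow> norm (lrl_vector (y t) (u t) - lrl_vector (x 0) (v 0)) \<le> max C1 C2 * h\<^sup>2" for t
        by (simp_all add: A0 flip: A_def)
    qed
  qed
qed

lemma modified_solution_exists:
  assumes x: "kepler_solution x v" and T: "0 \<le> T"
    and g: "C1_differentiable ((- {0}) \<times> UNIV) (\<lambda>(x, v). g x v)"
  shows "\<forall>\<^sub>F h in at_right 0. \<exists>y u. y 0 = x 0 \<and> u 0 = v 0 \<and>
    solves_second_order (truncated_modified_force kepler_force g h) (- {0}) 0 {0..T} y u"
proof -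
  obtain N \<delta> where N: "compact N" "N \<subseteq> (- {0}) \<times> UNIV" "0 < \<delta>"
    and tube: "\<And>t. t \<in> {0..T} \<Longrightarrow> cball (x t, v t) \<delta> \<subseteq> N"
    using tube_around_solution[OF x, of T] by blast
  obtain C where C: "0 \<le> C" "\<And>h. h \<in> {0..1} \<Longrightarrow> C-lipschitz_on N (modified_field g h)"
    using modified_field_bounds[OF g N(1,2)] by (metis (no_types, lifting))
  obtain B where B: "0 \<le> B" "\<And>z. z \<in> N \<Longrightarrow> norm (g (fst z) (snd z)) \<le> B"
    using bounded_lipschitz_onE[OF bounded_lipschitz_on_forces(2)[OF g N(1,2)]] by blast
  define X where "X = exp ((C + 1) * T)"
  have BX: "0 < B * X + 1" using B by (simp add: X_def add_nonneg_pos)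
  show ?thesis unfolding eventually_at_right_field
  proof (intro exI[of _ "min 1 (\<delta> / (B * X + 1))"] conjI allI impI)
    show "0 < min 1 (\<delta> / (B * X + 1))" using N(3) BX by simp
    fix h :: real assume h: "0 < h" "h < min 1 (\<delta> / (B * X + 1))"
    then have hI: "h \<in> {0..1}" by simp
    have "h\<^sup>2 \<le> h" using h by (simp add: power2_eq_square mult_left_le)
    then have "(B * X) * h\<^sup>2 \<le> (B * X) * h" using B by (intro mult_left_mono) (auto simp: X_def)
    also have "\<dots> \<le> (B * X + 1) * h" using h by simp
    also have "\<dots> < \<delta>" using h BX by (simp add: pos_less_divide_eq mult.commute)
    finally have small: "(h\<^sup>2 * B) * exp ((C + 1) * T) < \<delta>" by (simp add: X_def mult_ac)
    have "norm (modified_field g h z - modified_field g 0 z) \<le> h\<^sup>2 * B" if "z \<in> N" for z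
      using B(2)[OF that] by (simp add: modified_field_def truncated_modified_force_def mult_left_mono)
    then obtain Z where Z: "Z 0 = (x 0, v 0)"
      "\<And>t. t \<in> {0..T} \<Longrightarrow> (Z has_vector_derivative modified_field g h (Z t)) (at t within {0..T})"
      "\<And>t. t \<in> {0..T} \<Longrightarrow> norm (Z t - (x t, v t)) \<le> (h\<^sup>2 * B) * exp ((C + 1) * T)"
      using perturbed_solution_exists[OF kepler_solutionD(4)[OF x] tube C(2) C(2)[OF hI] _ _ small T] B(1)
      by (metis atLeastAtMost_iff mult_nonneg_nonneg order_refl zero_le_one zero_le_power2)
    have "Z t \<in> N" if "t \<in> {0..T}" for t
    proof -
      have "Z t \<in> cball (x t, v t) \<delta>"
        using Z(3)[OF that] small by (simp add: dist_norm norm_minus_commute)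
      then show ?thesis using tube[OF that] by blast
    qed
    then have nz: "fst (Z t) \<noteq> 0" if "t \<in> {0..T}" for t
      using subsetD[OF N(2)] that by (metis Compl_iff insertI1 mem_Times_iff)
    have "solves_second_order (truncated_modified_force kepler_force g h) (- {0}) 0 {0..T}
      (\<lambda>t. fst (Z t)) (\<lambda>t. snd (Z t))"
      by (rule solves_modified_fieldI[OF Z(2) nz])
    then show "\<exists>y u. y 0 = x 0 \<and> u 0 = v 0 \<and>
        solves_second_order (truncated_modified_force kepler_force g h) (- {0}) 0 {0..T} y u"
      using Z(1) by (intro exI[of _ "\<lambda>t. fst (Z t)"] exI[of _ "\<lambda>t. snd (Z t)"]) simp
  qed
qed

section \<open>The angle of a vector that moves little\<close>

text \<open>
  The error is in fact cubic; a quadratic bound is enough because it will be applied to \<open>z = O(h\<^sup>2)\<close>.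
\<close>

lemma arctan_linear_error: "\<bar>arctan z - z\<bar> \<le> z\<^sup>2"
proof -
  have "norm ((arctan z - z) - (arctan 0 - 0)) \<le> \<bar>z\<bar> * norm (z - 0)"
  proof (rule field_differentiable_bound[where S = "cball 0 \<bar>z\<bar>" and f' = "\<lambda>s. inverse (1 + s\<^sup>2) - 1"])
    fix s :: real assume s: "s \<in> cball 0 \<bar>z\<bar>"
    show "((\<lambda>s. arctan s - s) has_field_derivative inverse (1 + s\<^sup>2) - 1) (at s within cball 0 \<bar>z\<bar>)"
      by (auto intro!: derivative_eq_intros)
    have "\<bar>inverse (1 + s\<^sup>2) - 1\<bar> = s\<^sup>2 / (1 + s\<^sup>2)"
    proof -
      have pos: "0 < 1 + s\<^sup>2" by (simp add: add_pos_nonneg)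
      then have "inverse (1 + s\<^sup>2) - 1 = - (s\<^sup>2 / (1 + s\<^sup>2))" by (simp add: field_simps)
      then show ?thesis using pos by simp
    qed
    also have "\<dots> \<le> \<bar>s\<bar>"
    proof -
      have "\<bar>s\<bar> * \<bar>s\<bar> \<le> \<bar>s\<bar> * (1 + s\<^sup>2)"
        using sum_squares_bound[of 1 "\<bar>s\<bar>"] by (intro mult_left_mono) auto
      then show ?thesis by (simp add: pos_divide_le_eq add_pos_nonneg power2_eq_square)
    qed
    finally show "norm (inverse (1 + s\<^sup>2) - 1) \<le> \<bar>z\<bar>" using s by simp
  qed auto
  then show ?thesis by (simp add: power2_eq_square)
qed

lemma inner_pos_near:
  fixes a b :: "'a::real_inner"
  assumes "norm (b - a) < norm a"
  shows "0 < a \<bullet> b"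
proof -
  have "\<bar>a \<bullet> (b - a)\<bar> \<le> norm a * norm (b - a)" by (rule Cauchy_Schwarz_ineq2)
  also have "\<dots> < norm a * norm a"
    using assms norm_ge_zero[of "b - a"] by (intro mult_strict_left_mono) auto
  finally show ?thesis by (simp add: inner_diff_right abs_if power2_norm_eq_inner[symmetric] power2_eq_square split: if_splits)
qed

text \<open>
  While the vector stays in the open half-plane around its initial direction, a continuous angle cannot
  jump by multiples of \<open>\<pi>\<close>, so the principal value of the arctangent is the right one.
\<close>

lemma continuous_angle_change:
  assumes \<omega>: "is_continuous_angle {0..T} w \<omega>" and T: "0 \<le> T"
    and near: "\<And>t. t \<in> {0..T} \<Longrightarrow> norm (w t - w 0) < norm (w 0)"
  shows "\<omega> T - \<omega> 0 = arctan ((rot (w 0) \<bullet> w T) / (w 0 \<bullet> w T))"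
proof -
  define \<Delta> where "\<Delta> t = \<omega> t - \<omega> 0" for t
  have cont: "continuous_on {0..T} \<Delta>"
    using \<omega> unfolding is_continuous_angle_def \<Delta>_def by (intro continuous_intros) auto
  have w: "w t $ 1 = norm (w t) * cos (\<omega> t)" "w t $ 2 = norm (w t) * sin (\<omega> t)" "w t \<noteq> 0"
    if "t \<in> {0..T}" for t
    using \<omega> that by (auto simp: is_continuous_angle_def)
  have dot: "w 0 \<bullet> w t = norm (w 0) * norm (w t) * cos (\<Delta> t)"
    and cross: "rot (w 0) \<bullet> w t = norm (w 0) * norm (w t) * sin (\<Delta> t)" if "t \<in> {0..T}" for t
    using w(1,2)[OF that] w(1,2)[of 0] T
    by (simp_all add: inner_2 \<Delta>_def cos_diff sin_diff algebra_simps)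
  have cos_pos: "0 < cos (\<Delta> t)" if "t \<in> {0..T}" for t
  proof -
    have "0 < norm (w 0) * norm (w t)" using w(3)[OF that] w(3)[of 0] T by simp
    then show ?thesis
      using inner_pos_near[OF near[OF that]] unfolding dot[OF that] by (rule zero_less_mult_pos[rotated])
  qed
  have \<Delta>0: "\<Delta> 0 = 0" by (simp add: \<Delta>_def)
  have "\<Delta> T < pi / 2"
  proof (rule ccontr)
    assume "\<not> ?thesis"
    then obtain s where s: "0 \<le> s" "s \<le> T" "\<Delta> s = pi / 2"
      using IVT'[of \<Delta> 0 "pi / 2" T] cont T \<Delta>0 pi_ge_zero by auto
    then have "cos (\<Delta> s) = 0" by (simp only: cos_minus cos_pi_half)
    then show False using cos_pos[of s] s by simp
  qed
  moreover have "- (pi / 2) < \<Delta> T"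
  proof (rule ccontr)
    assume "\<not> ?thesis"
    then obtain s where s: "0 \<le> s" "s \<le> T" "\<Delta> s = - (pi / 2)"
      using IVT2'[of \<Delta> T "- (pi / 2)" 0] cont T \<Delta>0 pi_ge_zero by auto
    then have "cos (\<Delta> s) = 0" by (simp only: cos_minus cos_pi_half)
    then show False using cos_pos[of s] s by simp
  qed
  ultimately have "arctan (tan (\<Delta> T)) = \<Delta> T" by (simp add: arctan_tan)
  moreover have "tan (\<Delta> T) = (rot (w 0) \<bullet> w T) / (w 0 \<bullet> w T)"
    using w(3)[of 0] w(3)[of T] T by (simp add: dot cross tan_def)
  ultimately show ?thesis by (simp add: \<Delta>_def)
qed

lemma continuous_angle_exists:
  assumes cont: "continuous_on {0..T} w" and T: "0 \<le> T"
    and near: "\<And>t. t \<in> {0..T} \<Longrightarrow> norm (w t - w 0) < norm (w 0)"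
  shows "\<exists>\<omega>. is_continuous_angle {0..T} w \<omega>"
proof -
  define \<rho> where "\<rho> = norm (w 0)"
  have \<rho>: "0 < \<rho>" using near[of 0] T by (simp add: \<rho>_def)
  have "(w 0 $ 1)\<^sup>2 + (w 0 $ 2)\<^sup>2 = \<rho>\<^sup>2"
    unfolding \<rho>_def power2_norm_eq_inner by (simp add: inner_2 power2_eq_square)
  then have "(w 0 $ 1 / \<rho>)\<^sup>2 + (w 0 $ 2 / \<rho>)\<^sup>2 = 1"
    using \<rho> by (simp add: power_divide flip: add_divide_distrib)
  then obtain \<omega>\<^sub>0 where \<omega>\<^sub>0: "w 0 $ 1 / \<rho> = cos \<omega>\<^sub>0" "w 0 $ 2 / \<rho> = sin \<omega>\<^sub>0"
    by (metis sincos_total_2pi)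
  define p where "p t = w 0 \<bullet> w t" for t
  define q where "q t = rot (w 0) \<bullet> w t" for t
  have p: "0 < p t" if "t \<in> {0..T}" for t
    unfolding p_def by (rule inner_pos_near[OF near[OF that]])
  have pq: "(p t)\<^sup>2 + (q t)\<^sup>2 = (\<rho> * norm (w t))\<^sup>2" for t
    unfolding \<rho>_def power_mult_distrib power2_norm_eq_inner p_def q_def
    by (simp add: inner_2 power2_eq_square algebra_simps)
  have "is_continuous_angle {0..T} w (\<lambda>t. \<omega>\<^sub>0 + arctan (q t / p t))"
    unfolding is_continuous_angle_def
  proof (intro conjI ballI)
    have "continuous_on {0..T} (\<lambda>t. q t / p t)"
      unfolding p_def q_def using p[unfolded p_def] by (intro continuous_intros cont) force
    then show "continuous_on {0..T} (\<lambda>t. \<omega>\<^sub>0 + arctan (q t / p t))"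
      by (intro continuous_on_add continuous_on_const continuous_on_arctan)
    fix t assume t: "t \<in> {0..T}"
    show nz: "w t \<noteq> 0" using p[OF t] by (auto simp: p_def)
    define k where "k = \<rho> * norm (w t)"
    have k: "0 < k" using \<rho> nz by (simp add: k_def)
    have "1 + (q t / p t)\<^sup>2 = (k / p t)\<^sup>2"
      using p[OF t] pq[of t] by (simp add: k_def power_divide field_simps)
    then have "sqrt (1 + (q t / p t)\<^sup>2) = k / p t"
      using p[OF t] k by (simp add: real_sqrt_abs)
    then have ca: "cos (arctan (q t / p t)) = p t / k" "sin (arctan (q t / p t)) = q t / k"
      using p[OF t] by (simp_all add: cos_arctan sin_arctan)
    have "p t * w 0 $ 1 - q t * w 0 $ 2 = \<rho>\<^sup>2 * w t $ 1" "p t * w 0 $ 2 + q t * w 0 $ 1 = \<rho>\<^sup>2 * w t $ 2"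
      unfolding p_def q_def \<rho>_def power2_norm_eq_inner
      by (simp_all add: inner_2 power2_eq_square algebra_simps)
    then have "(p t * w 0 $ 1 - q t * w 0 $ 2) / \<rho>\<^sup>2 = w t $ 1" "(p t * w 0 $ 2 + q t * w 0 $ 1) / \<rho>\<^sup>2 = w t $ 2"
      using \<rho> by (simp_all add: field_simps)
    then show "w t $ 1 = norm (w t) * cos (\<omega>\<^sub>0 + arctan (q t / p t))"
      "w t $ 2 = norm (w t) * sin (\<omega>\<^sub>0 + arctan (q t / p t))"
      using \<rho> nz by (simp_all add: cos_add sin_add ca k_def \<omega>\<^sub>0[symmetric] power2_eq_square field_simps)
  qed
  then show ?thesis by blast
qed

text \<open>
  To first order the angle between \<open>a\<close> and a nearby vector is the transversal displacement divided by
  the length of \<open>a\<close>; the cross product contributes one more factor of that length.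
\<close>

lemma arctan_angle_expansion:
  fixes a b :: "real^2"
  assumes a: "a \<noteq> 0" and near: "norm (b - a) \<le> \<epsilon>" "\<epsilon> \<le> norm a / 2"
  shows "\<bar>arctan ((rot a \<bullet> b) / (a \<bullet> b)) - (rot a \<bullet> (b - a)) / (norm a)\<^sup>2\<bar> \<le> 6 * \<epsilon>\<^sup>2 / (norm a)\<^sup>2"
proof -
  define n where "n = norm a"
  define p where "p = a \<bullet> b"
  define q where "q = rot a \<bullet> b"
  have n: "0 < n" using a by (simp add: n_def)
  have \<epsilon>: "0 \<le> \<epsilon>" using order_trans[OF norm_ge_zero near(1)] .
  have q_eq: "q = rot a \<bullet> (b - a)" by (simp add: q_def inner_diff_right rot_simps)
  have "\<bar>q\<bar> \<le> norm (rot a) * norm (b - a)" unfolding q_eq by (rule Cauchy_Schwarz_ineq2)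
  also have "\<dots> \<le> n * \<epsilon>" using near n by (simp add: n_def mult_left_mono)
  finally have q: "\<bar>q\<bar> \<le> n * \<epsilon>" .
  have "\<bar>a \<bullet> (b - a)\<bar> \<le> norm a * norm (b - a)" by (rule Cauchy_Schwarz_ineq2)
  also have "\<dots> \<le> n * \<epsilon>" using near n by (simp add: n_def mult_left_mono)
  finally have pn: "\<bar>p - n\<^sup>2\<bar> \<le> n * \<epsilon>"
    by (simp add: p_def n_def inner_diff_right power2_norm_eq_inner)
  have "n * \<epsilon> \<le> n * (n / 2)" using near n by (intro mult_left_mono) (auto simp: n_def)
  then have p: "n\<^sup>2 / 2 \<le> p" using pn by (simp add: power2_eq_square abs_le_iff)
  have n2: "0 < n\<^sup>2" using n by simp
  have pp: "0 < p" using p n2 by linarith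
  have "\<bar>q / p\<bar> \<le> (n * \<epsilon>) / (n\<^sup>2 / 2)"
    unfolding abs_divide using q p pp n2 n \<epsilon> by (intro frac_le) auto
  also have "\<dots> = 2 * \<epsilon> / n" using n by (simp add: power2_eq_square)
  finally have qp: "\<bar>q / p\<bar> \<le> 2 * \<epsilon> / n" .
  then have "(q / p)\<^sup>2 \<le> (2 * \<epsilon> / n)\<^sup>2"
    using power_mono[OF qp, of 2] by (simp only: power2_abs abs_ge_zero)
  then have 1: "\<bar>arctan (q / p) - q / p\<bar> \<le> (2 * \<epsilon> / n)\<^sup>2"
    using arctan_linear_error[of "q / p"] by linarith
  have "q / p - q / n\<^sup>2 = - (q / p) * ((p - n\<^sup>2) / n\<^sup>2)"
    using pp n2 by (simp add: field_simps)
  then have "\<bar>q / p - q / n\<^sup>2\<bar> = \<bar>q / p\<bar> * (\<bar>p - n\<^sup>2\<bar> / n\<^sup>2)"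
    by (simp add: abs_mult)
  also have "\<dots> \<le> (2 * \<epsilon> / n) * ((n * \<epsilon>) / n\<^sup>2)"
    using qp pn n \<epsilon> by (intro mult_mono divide_right_mono) auto
  also have "\<dots> = 2 * \<epsilon>\<^sup>2 / n\<^sup>2" using n by (simp add: power2_eq_square)
  finally have 2: "\<bar>q / p - q / n\<^sup>2\<bar> \<le> 2 * \<epsilon>\<^sup>2 / n\<^sup>2" .
  have "\<bar>arctan (q / p) - q / n\<^sup>2\<bar> \<le> (2 * \<epsilon> / n)\<^sup>2 + 2 * \<epsilon>\<^sup>2 / n\<^sup>2"
    using 1 2 by linarith
  also have "\<dots> = 6 * \<epsilon>\<^sup>2 / n\<^sup>2" by (simp add: power_divide power_mult_distrib)
  finally show ?thesis by (simp only: q_eq[symmetric] q_def[symmetric] p_def[symmetric] n_def[symmetric])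
qed

section \<open>The numerical precession rate\<close>

theorem theorem6:
  fixes x v :: "real \<Rightarrow> real^2" and F :: "real^2" and a b L T :: real
    and g :: "real^2 \<Rightarrow> real^2 \<Rightarrow> real^2"
  assumes kepler: "solves_second_order (\<lambda>y _. kepler_force y) (- {0}) 0 UNIV x v"
    and energy: "kepler_energy (x 0) (v 0) < 0"
    and momentum: "L = angular_momentum (x 0) (v 0)" "L \<noteq> 0"
    and orbit: "is_ellipse 0 F a b (range x)"
    and eccentricity: "0 < sqrt (1 - b ^ 2 / a ^ 2)"
    and period: "is_minimal_period x T"
    and modified: "verlet_modified_term kepler_force (- {0}) g"
  shows "(\<forall>\<^sub>F h in at_right 0. \<exists>\<delta>. is_precession g (x 0) (v 0) T 0 h \<delta>) \<and>
    (\<forall>K P. (\<forall>\<^sub>F h in at_right 0. is_precession g (x 0) (v 0) T K h (P h)) \<longrightarrow>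
       (\<lambda>h. P h - (- sgn L * (pi / 24) * (15 * a ^ 3 / b ^ 6 - 3 * a / b ^ 4) * h ^ 2))
         \<in> O[at_right 0](\<lambda>h. h ^ 4))"
proof -
  have x: "kepler_solution x v"
    using kepler unfolding solves_second_order_def kepler_solution_def by auto
  have T: "0 < T" using period by (simp add: is_minimal_period_def)
  have g: "C1_differentiable ((- {0}) \<times> UNIV) (\<lambda>(x, v). g x v)"
    using modified by (simp add: verlet_modified_term_def)
  define A where "A = lrl_vector (x 0) (v 0)"
  define e where "e = norm A"
  define u where "u = (1 / e) *\<^sub>R A"
  have "norm p + A \<bullet> p = L\<^sup>2" if p: "p \<in> range x" for p
  proof -
    obtain t where "p = x t" using p by blast
    then show ?thesis
      using orbit_equation[OF kepler_solutionD(1)[OF x], of t "v t"]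
      by (simp only: A_def momentum(1) kepler_constants[OF x, of t])
  qed
  note shape = ellipse_focal_equation[OF orbit this]
  have ab: "0 < a" "0 < b" using orbit by (auto simp: is_ellipse_def)
  have e2: "e\<^sup>2 = 1 - b\<^sup>2 / a\<^sup>2" using shape(3) by (simp add: e_def)
  have "0 < e\<^sup>2" using eccentricity unfolding e2 real_sqrt_gt_0_iff .
  then have e: "0 < e" by (simp add: e_def)
  have A_nz: "A \<noteq> 0" using e by (auto simp: e_def)
  have u: "norm u = 1" "A = e *\<^sub>R u" using e by (auto simp: u_def e_def)
  obtain \<theta> where d\<theta>: "\<And>t. t \<in> {0..T} \<Longrightarrow> (\<theta> has_real_derivative L / (norm (x t))\<^sup>2) (at t within {0..T})"
    and polar: "\<And>t. t \<in> {0..T} \<Longrightarrow> x t = norm (x t) *\<^sub>R (cos (\<theta> t) *\<^sub>R u + sin (\<theta> t) *\<^sub>R rot u)"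
    using kepler_true_anomaly[OF x momentum(1) u(1)] by blast
  note state = kepler_orbit_angle_determines_state[OF x momentum u(1) u(2)[unfolded A_def] polar]
  have \<theta>T: "\<theta> T = \<theta> 0 + 2 * pi * sgn L"
    by (rule true_anomaly_over_period[OF x momentum u(1) u(2)[unfolded A_def] period d\<theta> polar])
  \<comment> \<open>The component along \<open>rot A\<close> is the one that turns the vector; its drift is the increment of \<open>W\<close>.\<close>
  define W where "W t = precession_primitive e (\<theta> t) / L ^ 6" for t
  have dW: "(W has_real_derivative rot A \<bullet> lrl_rate (x t) (v t) (g (x t) (v t))) (at t within {0..T})"
    if t: "t \<in> {0..T}" for t
  proof -
    have "(W has_real_derivative
        precession_integrand e (cos (\<theta> t)) (1 + 2 * e * cos (\<theta> t) + e\<^sup>2) * (L / (norm (x t))\<^sup>2) / L ^ 6)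
        (at t within {0..T})"
      unfolding W_def[abs_def]
      by (intro DERIV_cdivide DERIV_chain2[OF precession_primitive_derivative d\<theta>[OF t]])
    also have "precession_integrand e (cos (\<theta> t)) (1 + 2 * e * cos (\<theta> t) + e\<^sup>2) * (L / (norm (x t))\<^sup>2) / L ^ 6
        = rot (e *\<^sub>R u) \<bullet> lrl_rate (x t) (v t) (kepler_verlet_term (x t) (v t))"
      using precession_integrand_eq[OF u(1) momentum(2) _ kepler_solutionD(1)[OF x] state(1)[OF t] polar[OF t] state(2)[OF t]]
      by simp
    finally show ?thesis
      using verlet_modified_term_unique[OF modified kepler_solutionD(1)[OF x]] by (simp add: u(2))
  qed
  have "W T - W 0 = - (e\<^sup>2 * (4 + e\<^sup>2) / 16) * (2 * pi * sgn L) / L ^ 6"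
  proof -
    have "sgn L = 1 \<or> sgn L = - 1" using momentum(2) by (simp add: sgn_if)
    then have cs: "cos (\<theta> T) = cos (\<theta> 0)" "sin (\<theta> T) = sin (\<theta> 0)"
      using cos_periodic[of "\<theta> 0 - 2 * pi"] sin_periodic[of "\<theta> 0 - 2 * pi"] by (auto simp: \<theta>T)
    have "k * p + X - (k * q + X) = k * (p - q)" for k p q X :: real
      by (simp add: algebra_simps)
    then have "precession_primitive e (\<theta> T) - precession_primitive e (\<theta> 0) = - (e\<^sup>2 * (4 + e\<^sup>2) / 16) * (\<theta> T - \<theta> 0)"
      by (simp only: precession_primitive_def cs)
    then show ?thesis by (simp add: W_def \<theta>T flip: diff_divide_distrib)
  qed
  also have "\<dots> = e\<^sup>2 * (- sgn L * (pi / 24) * (15 * a ^ 3 / b ^ 6 - 3 * a / b ^ 4))"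
  proof -
    have "L ^ 6 = (b\<^sup>2 / a) ^ 3" by (simp flip: shape(1))
    then have L6: "L ^ 6 = b ^ 6 / a ^ 3" by (simp add: power_divide)
    have eq: "(4 + e\<^sup>2) / (b ^ 6 / a ^ 3) = (15 * a ^ 3 / b ^ 6 - 3 * a / b ^ 4) / 3"
    proof -
      have "a ^ 3 / b ^ 6 = a\<^sup>2 * a / (b\<^sup>2 * b ^ 4)" by (simp add: eval_nat_numeral)
      then have "b\<^sup>2 / a\<^sup>2 * (a ^ 3 / b ^ 6) = b\<^sup>2 / a\<^sup>2 * (a\<^sup>2 * a / (b\<^sup>2 * b ^ 4))" by (rule arg_cong)
      also have "\<dots> = a / b ^ 4" using ab by (simp add: field_simps)
      finally have "b\<^sup>2 / a\<^sup>2 * (a ^ 3 / b ^ 6) = a / b ^ 4" .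
      moreover have "(4 + e\<^sup>2) / (b ^ 6 / a ^ 3) = (5 - b\<^sup>2 / a\<^sup>2) * (a ^ 3 / b ^ 6)"
        by (simp add: e2)
      ultimately show ?thesis unfolding left_diff_distrib by simp
    qed
    have "- (e\<^sup>2 * (4 + e\<^sup>2) / 16) * (2 * pi * sgn L) / L ^ 6
        = - (e\<^sup>2 / 16) * (2 * pi * sgn L) * ((4 + e\<^sup>2) / (b ^ 6 / a ^ 3))"
      by (simp add: L6)
    moreover have "- (p / 16) * (2 * pi * s) * (R / 3) = p * (- s * (pi / 24) * R)" for p s R :: real
      by simp
    ultimately show ?thesis unfolding eq by simp
  qed
  finally have WT: "W T - W 0 = e\<^sup>2 * (- sgn L * (pi / 24) * (15 * a ^ 3 / b ^ 6 - 3 * a / b ^ 4))" .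
  have small: "\<forall>\<^sub>F h in at_right 0. C * h\<^sup>2 < e / 2" for C
  proof -
    have "((\<lambda>h. C * h\<^sup>2) \<longlongrightarrow> C * 0\<^sup>2) (at_right 0)" by (intro tendsto_intros)
    then show ?thesis by (rule order_tendstoD) (use e in simp)
  qed
  have "\<forall>\<^sub>F h in at_right 0. \<exists>\<delta>. is_precession g (x 0) (v 0) T 0 h \<delta>"
  proof -
    obtain C where C: "0 \<le> C" "\<forall>\<^sub>F h in at_right 0. \<forall>y w. y 0 = x 0 \<longrightarrow> w 0 = v 0 \<longrightarrow>
        solves_second_order (truncated_modified_force kepler_force g h) (- {0}) (0 * h ^ 4) {0..T} y w \<longrightarrow>
        (\<forall>t\<in>{0..T}. norm (lrl_vector (y t) (w t) - lrl_vector (x 0) (v 0)) \<le> C * h\<^sup>2) \<and>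
        \<bar>rot A \<bullet> (lrl_vector (y T) (w T) - lrl_vector (x 0) (v 0)) - h\<^sup>2 * (W T - W 0)\<bar> \<le> C * h ^ 4"
      by (rule lrl_vector_drift[where K = 0, OF x less_imp_le[OF T] g dW])
    from C(2) small[of C] modified_solution_exists[OF x less_imp_le[OF T] g] show ?thesis
    proof eventually_elim
      case (elim h)
      then obtain y w where y: "y 0 = x 0" "w 0 = v 0"
        "solves_second_order (truncated_modified_force kepler_force g h) (- {0}) (0 * h ^ 4) {0..T} y w"
        by auto
      have drift: "norm (lrl_vector (y t) (w t) - A) \<le> C * h\<^sup>2" if "t \<in> {0..T}" for t
        using elim(1) y that unfolding A_def by blast
      have near: "norm (lrl_vector (y t) (w t) - lrl_vector (y 0) (w 0)) < norm (lrl_vector (y 0) (w 0))"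
        if "t \<in> {0..T}" for t
        using drift[OF that] elim(2) e unfolding y(1,2) A_def[symmetric] e_def[symmetric] by linarith
      have "continuous_on {0..T} (\<lambda>t. lrl_vector (y t) (w t))"
      proof (rule solves_second_orderE[OF y(3)])
        fix w'
        assume w': "\<And>t. t \<in> {0..T} \<Longrightarrow> y t \<in> - {0}"
          "\<And>t. t \<in> {0..T} \<Longrightarrow> (y has_vector_derivative w t) (at t within {0..T})"
          "\<And>t. t \<in> {0..T} \<Longrightarrow> (w has_vector_derivative w' t) (at t within {0..T})"
        have "y t \<noteq> 0" if "t \<in> {0..T}" for t using w'(1)[OF that] by simp
        with w'(2,3) show ?thesis
          by (intro continuous_on_vector_derivative) (rule lrl_vector_along_curve)
      qed
      then obtain \<omega> where \<omega>: "is_continuous_angle {0..T} (\<lambda>t. lrl_vector (y t) (w t)) \<omega>"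
        using continuous_angle_exists[where w = "\<lambda>t. lrl_vector (y t) (w t)", OF _ less_imp_le[OF T] near] by blast
      show ?case unfolding is_precession_def
        by (rule exI[of _ "\<omega> T - \<omega> 0"], rule exI[of _ y], rule exI[of _ w], rule exI[of _ \<omega>])
          (intro conjI y \<omega> refl)
    qed
  qed
  moreover have "(\<lambda>h. P h - (- sgn L * (pi / 24) * (15 * a ^ 3 / b ^ 6 - 3 * a / b ^ 4) * h ^ 2))
      \<in> O[at_right 0](\<lambda>h. h ^ 4)"
    if P: "\<forall>\<^sub>F h in at_right 0. is_precession g (x 0) (v 0) T K h (P h)" for K P
  proof -
    obtain C where C: "0 \<le> C" "\<forall>\<^sub>F h in at_right 0. \<forall>y w. y 0 = x 0 \<longrightarrow> w 0 = v 0 \<longrightarrow>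
        solves_second_order (truncated_modified_force kepler_force g h) (- {0}) (K * h ^ 4) {0..T} y w \<longrightarrow>
        (\<forall>t\<in>{0..T}. norm (lrl_vector (y t) (w t) - lrl_vector (x 0) (v 0)) \<le> C * h\<^sup>2) \<and>
        \<bar>rot A \<bullet> (lrl_vector (y T) (w T) - lrl_vector (x 0) (v 0)) - h\<^sup>2 * (W T - W 0)\<bar> \<le> C * h ^ 4"
      by (rule lrl_vector_drift[where K = K, OF x less_imp_le[OF T] g dW])
    let ?c = "- sgn L * (pi / 24) * (15 * a ^ 3 / b ^ 6 - 3 * a / b ^ 4)"
    from P C(2) small[of C] have "\<forall>\<^sub>F h in at_right 0. norm (P h - ?c * h\<^sup>2) \<le> ((6 * C\<^sup>2 + C) / e\<^sup>2) * norm (h ^ 4)"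
    proof eventually_elim
      case (elim h)
      obtain y w \<omega> where y: "solves_second_order (truncated_modified_force kepler_force g h) (- {0}) (K * h ^ 4) {0..T} y w"
        "y 0 = x 0" "w 0 = v 0" and \<omega>: "is_continuous_angle {0..T} (\<lambda>t. lrl_vector (y t) (w t)) \<omega>"
        and Ph: "P h = \<omega> T - \<omega> 0"
        using elim(1) unfolding is_precession_def by blast
      define B where "B t = lrl_vector (y t) (w t)" for t
      have B0: "B 0 = A" by (simp add: B_def y A_def)
      have "(\<forall>t\<in>{0..T}. norm (B t - A) \<le> C * h\<^sup>2) \<and> \<bar>rot A \<bullet> (B T - A) - h\<^sup>2 * (W T - W 0)\<bar> \<le> C * h ^ 4"
        using elim(2) y unfolding B_def A_def by blast
      then have drift: "\<And>t. t \<in> {0..T} \<Longrightarrow> norm (B t - A) \<le> C * h\<^sup>2"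
        "\<bar>rot A \<bullet> (B T - A) - h\<^sup>2 * (W T - W 0)\<bar> \<le> C * h ^ 4" by blast+
      have "norm (B t - B 0) < norm (B 0)" if "t \<in> {0..T}" for t
        using drift(1)[OF that] elim(3) e by (simp add: B0 flip: e_def)
      then have "P h = arctan ((rot A \<bullet> B T) / (A \<bullet> B T))"
        using continuous_angle_change[OF \<omega>[folded B_def]] T by (simp add: Ph B0)
      then have 1: "\<bar>P h - (rot A \<bullet> (B T - A)) / e\<^sup>2\<bar> \<le> 6 * (C * h\<^sup>2)\<^sup>2 / e\<^sup>2"
        using arctan_angle_expansion[OF A_nz drift(1)[of T], folded e_def] elim(3) T by simp
      have "X / e\<^sup>2 - k * h\<^sup>2 = (X - h\<^sup>2 * (e\<^sup>2 * k)) / e\<^sup>2" for X k :: real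
        using e by (simp add: diff_divide_distrib)
      then have "(rot A \<bullet> (B T - A)) / e\<^sup>2 - ?c * h\<^sup>2 = (rot A \<bullet> (B T - A) - h\<^sup>2 * (W T - W 0)) / e\<^sup>2"
        unfolding WT .
      then have 2: "\<bar>(rot A \<bullet> (B T - A)) / e\<^sup>2 - ?c * h\<^sup>2\<bar> \<le> C * h ^ 4 / e\<^sup>2"
        using divide_right_mono[OF drift(2) zero_le_power2[of e]] by (simp only: abs_divide abs_power2)
      have "\<bar>P h - ?c * h\<^sup>2\<bar> \<le> 6 * (C * h\<^sup>2)\<^sup>2 / e\<^sup>2 + C * h ^ 4 / e\<^sup>2"
        using 1 2 by linarith
      also have "\<dots> = ((6 * C\<^sup>2 + C) / e\<^sup>2) * norm (h ^ 4)"
        by (simp add: power_mult_distrib add_divide_distrib distrib_right flip: power_mult)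
      finally show ?case by simp
    qed
    then show ?thesis by (rule bigoI)
  qed
  ultimately show ?thesis by blast
qed

end
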